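(* Let $(T,\trianglelefteq,\sim)$ be a colored tree, let $L$ be a join-semilattice, let $e\colon T\to L^-$ be an $L$-valued norm on $T$, and let $\mathbb{F}$ be a totally ordered division ring. Let $\mathbb{V}_T$ be the vector space and $\Omega_T=\{\overline{p}\mid p\in T\}\subseteq\mathbb{V}_T$ the subset associated with $T$ and $\mathbb{F}$. Then the rule $$\psi(x)=\{\overline{p}\mid p\in T\text{ and }e(p)\leq x\},\qquad x\in L,$$ defines a join-homomorphism $\psi\colon L\to\mathbf{Co}(\mathbb{V}_T,\Omega_T)$ (in particular $\psi(x)\in\mathbf{Co}(\mathbb{V}_T,\Omega_T)$ for all $x\in L$), and $\psi$ preserves existing meets. Furthermore: (i) The map $\varphi\colon L\to\mathbf{Co}(\mathbb{V}_T)$ defined by $\varphi(x)=\mathrm{Co}(\psi(x))$, for all $x\in L$, is a plenary join-homomorphism from $L$ to $\mathbf{Co}(\mathbb{V}_T)$. (ii) Both $\psi$ and $\varphi$ are zero-preserving. (iii) If the norm $e$ is full, then both $\psi$ and $\varphi$ are embeddings.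
   Context: Convex sets. All vector spaces are left vector spaces. For a vector space $V$ over a totally ordered division ring $\mathbb{F}$, $\mathbf{Co}(V)$ is the lattice, under inclusion, of all convex subsets of $V$ (including $\varnothing$), where $X$ is convex if $\xi_0x+\xi_1y\in X$ whenever $x,y\in X$, $\xi_0,\xi_1\geq0$, $\xi_0+\xi_1=1$; $\mathrm{Co}(X)$ is the convex hull of $X$; for $\Omega\subseteq V$, $\mathbf{Co}(V,\Omega)=\{X\cap\Omega\mid X\in\mathbf{Co}(V)\}$, a lattice under inclusion, and $\varphi_\Omega\colon\mathbf{Co}(V,\Omega)\to\mathbf{Co}(V)$ is $X\mapsto\mathrm{Co}(X)$. The subset $\Omega$ is plenary if for every $x\in\mathrm{Co}(\Omega)$ there exists a least $X\in\mathbf{Co}(V,\Omega)$ with $x\in\mathrm{Co}(X)$. A map $f\colon K\to K'$ between posets preserves existing meets if whenever $X\subseteq K$ has a meet in $K$, $f[X]$ has a meet in $K'$ and $\bigwedge f[X]=f(\bigwedge X)$; it is zero-preserving if whenever $K$ has a smallest element $0_K$, $f(0_K)$ is the smallest element of $K'$. A map $\varphi\colon L\to\mathbf{Co}(V)$ from a join-semilattice is plenary if $\varphi=\varphi_\Omega\circ\psi$ for some plenary $\Omega\subseteq V$ and some join-homomorphism $\psi\colon L\to\mathbf{Co}(V,\Omega)$ preserving existing meets. Colored trees. A tree is a poset $(T,\trianglelefteq)$ such that $\{q\in T\mid q\trianglelefteq p\}$ is a finite chain for every $p\in T$. Write $p\prec q$ if $p$ is a lower cover of $q$; every non-minimal $q$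 has a unique lower cover, denoted $q_*$. A coloring of $T$ is an equivalence relation $\sim$ on $T$ such that (1) the $\sim$-class $[p]$ of every non-minimal $p$ is finite with at least two elements; (2) if $p\sim q$, then either both $p,q$ are minimal or $p_*=q_*$. A colored tree is a triple $(T,\trianglelefteq,\sim)$ with $\sim$ a coloring of the tree $(T,\trianglelefteq)$. Put $\mathcal{M}_T=\{(p,[q])\mid p,q\in T,\ p\prec q\}$ and $\mathcal{M}_T(p)=\{[q]\mid q\in T,\ p\prec q\}$. The space $\mathbb{V}_T$. Let $\mathbb{F}^{(T)}$ be the free left $\mathbb{F}$-vector space of finitely supported maps $T\to\mathbb{F}$, with canonical basis $(\dot p)_{p\in T}$, and $\mathbb{F}^{(T)}_+=\{x\mid x(p)\geq0\text{ for all }p\in T\}$. For $x,y\in\mathbb{F}^{(T)}_+$, write $x\longrightarrow^{1}y$ if there are $(p,I)\in\mathcal{M}_T$, $\lambda\geq0$ in $\mathbb{F}$ and $z\in\mathbb{F}^{(T)}_+$ with $x=\frac{\lambda}{|I|}\sum_{q\in I}\dot q+z$ and $y=\lambda\dot p+z$; let $\longrightarrow^{*}$ be the reflexive transitive closure of $\longrightarrow^{1}$; write $x\equiv y$ if there is $u\in\mathbb{F}^{(T)}_+$ with $x\longrightarrow^{*}u$ and $y\longrightarrow^{*}u$. Then $N_T=\{x-y\mid x,y\in\mathbb{F}^{(T)}_+,\ x\equiv y\}$ is a subspace of $\mathbb{F}^{(T)}$; put $\mathbb{V}_T=\mathbb{F}^{(T)}/N_T$ and $\overline{p}=\dot p+N_T$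 for $p\in T$. Norms. For a join-semilattice $L$, $L^-=L\setminus\{0\}$ if $L$ has a least element $0$, and $L^-=L$ otherwise. For $X,Y\subseteq L$, $X\ll Y$ means every element of $X$ lies below some element of $Y$. A nontrivial join-cover of $a\in L^-$ is a finite subset $X$ of $L^-$ with $a\leq\bigvee X$ and $a\nleq x$ for all $x\in X$. An $L$-valued norm on $T$ is a map $e\colon T\to L^-$ such that (1) for all $(p,I)\in\mathcal{M}_T$, $e[I]=\{e(q)\mid q\in I\}$ is a nontrivial join-cover of $e(p)$; (2) for all $p\in T$ and every nontrivial join-cover $X$ of $e(p)$, there exists $I\in\mathcal{M}_T(p)$ with $e[I]\ll X$. The norm $e$ is full if every $x\in L$ is the join of all elements of $e[T]$ below $x$. *)

theory Defs
  imports "HOL-Algebra.Lattice" "HOL-Algebra.Module" "HOL-Library.Poly_Mapping"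
    "HOL-Library.Set_Algebras" "HOL.Hull"
begin

text \<open>
  Totally ordered division rings are types of sort \<open>{division_ring, linordered_ring_strict}\<close>
  (not necessarily commutative; the operation \<open>abs\<close> in that sort is determined by the order).
  Posets are records of type \<^typ>\<open>'a gorder\<close>, vector spaces are records of type
  \<^typ>\<open>('f, 'v) module\<close> whose scalars form a whole type; the fields \<open>mult\<close> and \<open>one\<close>
  of such a record play no role.
\<close>


section \<open>Maps between posets\<close>

text \<open>Stated with \<open>is_lub\<close>, \<open>is_glb\<close> rather than with the choice operators \<open>join\<close>, \<open>inf\<close> of the
  target, so that the existence of the joins and meets in the target is part of the assertion.\<close>

definition join_hom :: "('a, 'm) gorder_scheme \<Rightarrow> ('b, 'n) gorder_scheme \<Rightarrow> ('a \<Rightarrow> 'b) \<Rightarrow> bool" where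
  "join_hom K K' f \<longleftrightarrow> f \<in> carrier K \<rightarrow> carrier K' \<and>
     (\<forall>x\<in>carrier K. \<forall>y\<in>carrier K. is_lub K' (f (x \<squnion>\<^bsub>K\<^esub> y)) {f x, f y})"

definition join_embedding :: "('a, 'm) gorder_scheme \<Rightarrow> ('b, 'n) gorder_scheme \<Rightarrow> ('a \<Rightarrow> 'b) \<Rightarrow> bool" where
  "join_embedding K K' f \<longleftrightarrow> join_hom K K' f \<and> inj_on f (carrier K)"

definition preserves_existing_meets ::
    "('a, 'm) gorder_scheme \<Rightarrow> ('b, 'n) gorder_scheme \<Rightarrow> ('a \<Rightarrow> 'b) \<Rightarrow> bool" where
  "preserves_existing_meets K K' f \<longleftrightarrow>
     (\<forall>X m. X \<subseteq> carrier K \<longrightarrow> is_glb K m X \<longrightarrow> is_glb K' (f m) (f ` X))"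

definition zero_preserving ::
    "('a, 'm) gorder_scheme \<Rightarrow> ('b, 'n) gorder_scheme \<Rightarrow> ('a \<Rightarrow> 'b) \<Rightarrow> bool" where
  "zero_preserving K K' f \<longleftrightarrow>
     (\<forall>z. least K z (carrier K) \<longrightarrow> least K' (f z) (carrier K'))"


section \<open>Convex sets in left vector spaces\<close>

locale left_vector_space = abelian_group V
  for V :: "('f::division_ring, 'v, 'm) module_scheme" (structure) +
  assumes smult_closed: "x \<in> carrier V \<Longrightarrow> a \<odot> x \<in> carrier V"
    and smult_l_distr: "x \<in> carrier V \<Longrightarrow> (a + b) \<odot> x = (a \<odot> x) \<oplus> (b \<odot> x)"
    and smult_r_distr: "x \<in> carrier V \<Longrightarrow> y \<in> carrier V \<Longrightarrow> a \<odot> (x \<oplus> y) = (a \<odot> x) \<oplus> (a \<odot> y)"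
    and smult_assoc: "x \<in> carrier V \<Longrightarrow> (a * b) \<odot> x = a \<odot> (b \<odot> x)"
    and smult_one: "x \<in> carrier V \<Longrightarrow> 1 \<odot> x = x"

definition convex_in ::
    "('f::{division_ring,linordered_ring_strict}, 'v, 'm) module_scheme \<Rightarrow> 'v set \<Rightarrow> bool" where
  "convex_in V X \<longleftrightarrow> X \<subseteq> carrier V \<and>
     (\<forall>x\<in>X. \<forall>y\<in>X. \<forall>a b. a \<ge> 0 \<and> b \<ge> 0 \<and> a + b = 1 \<longrightarrow> (a \<odot>\<^bsub>V\<^esub> x) \<oplus>\<^bsub>V\<^esub> (b \<odot>\<^bsub>V\<^esub> y) \<in> X)"

definition conv ::
    "('f::{division_ring,linordered_ring_strict}, 'v, 'm) module_scheme \<Rightarrow> 'v set \<Rightarrow> 'v set" where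
  "conv V X = convex_in V hull X"

definition Co :: "('f::{division_ring,linordered_ring_strict}, 'v, 'm) module_scheme \<Rightarrow> 'v set gorder" where
  "Co V = \<lparr>carrier = {X. convex_in V X}, eq = (=), le = (\<subseteq>)\<rparr>"

definition Co_rel ::
    "('f::{division_ring,linordered_ring_strict}, 'v, 'm) module_scheme \<Rightarrow> 'v set \<Rightarrow> 'v set gorder" where
  "Co_rel V \<Omega> = \<lparr>carrier = {X \<inter> \<Omega> | X. convex_in V X}, eq = (=), le = (\<subseteq>)\<rparr>"

definition plenary_set ::
    "('f::{division_ring,linordered_ring_strict}, 'v, 'm) module_scheme \<Rightarrow> 'v set \<Rightarrow> bool" where
  "plenary_set V \<Omega> \<longleftrightarrow> \<Omega> \<subseteq> carrier V \<and>
     (\<forall>x\<in>conv V \<Omega>. \<exists>X. least (Co_rel V \<Omega>) X {Y \<in> carrier (Co_rel V \<Omega>). x \<in> conv V Y})"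

definition plenary_map ::
    "('l, 'n) gorder_scheme \<Rightarrow> ('f::{division_ring,linordered_ring_strict}, 'v, 'm) module_scheme
      \<Rightarrow> ('l \<Rightarrow> 'v set) \<Rightarrow> bool" where
  "plenary_map L V \<phi> \<longleftrightarrow>
     (\<exists>\<Omega> \<psi>. plenary_set V \<Omega> \<and> join_hom L (Co_rel V \<Omega>) \<psi> \<and>
        preserves_existing_meets L (Co_rel V \<Omega>) \<psi> \<and> (\<forall>x\<in>carrier L. \<phi> x = conv V (\<psi> x)))"


section \<open>Colored trees\<close>

definition tree :: "('p, 'm) gorder_scheme \<Rightarrow> bool" where
  "tree T \<longleftrightarrow> partial_order T \<and>
     (\<forall>p\<in>carrier T. finite {q \<in> carrier T. q \<sqsubseteq>\<^bsub>T\<^esub> p} \<and>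
        (\<forall>q\<in>carrier T. \<forall>r\<in>carrier T. q \<sqsubseteq>\<^bsub>T\<^esub> p \<longrightarrow> r \<sqsubseteq>\<^bsub>T\<^esub> p \<longrightarrow> q \<sqsubseteq>\<^bsub>T\<^esub> r \<or> r \<sqsubseteq>\<^bsub>T\<^esub> q))"

definition lower_cover :: "('p, 'm) gorder_scheme \<Rightarrow> 'p \<Rightarrow> 'p \<Rightarrow> bool" where
  "lower_cover T p q \<longleftrightarrow> p \<in> carrier T \<and> q \<in> carrier T \<and> p \<sqsubset>\<^bsub>T\<^esub> q \<and>
     \<not> (\<exists>r\<in>carrier T. p \<sqsubset>\<^bsub>T\<^esub> r \<and> r \<sqsubset>\<^bsub>T\<^esub> q)"

definition minimal_in :: "('p, 'm) gorder_scheme \<Rightarrow> 'p \<Rightarrow> bool" where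
  "minimal_in T p \<longleftrightarrow> p \<in> carrier T \<and> \<not> (\<exists>q\<in>carrier T. q \<sqsubset>\<^bsub>T\<^esub> p)"

definition the_lower_cover :: "('p, 'm) gorder_scheme \<Rightarrow> 'p \<Rightarrow> 'p" where
  "the_lower_cover T q = (THE p. lower_cover T p q)"

text \<open>In the second condition the alternative to ``both minimal'' requires that both elements be
  non-minimal, as only then their lower covers are defined.\<close>

definition coloring :: "('p, 'm) gorder_scheme \<Rightarrow> ('p \<times> 'p) set \<Rightarrow> bool" where
  "coloring T C \<longleftrightarrow> equiv (carrier T) C \<and>
     (\<forall>p\<in>carrier T. \<not> minimal_in T p \<longrightarrow> finite (C `` {p}) \<and> card (C `` {p}) \<ge> 2) \<and>
     (\<forall>(p, q)\<in>C. minimal_in T p \<and> minimal_in T q \<or>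
        \<not> minimal_in T p \<and> \<not> minimal_in T q \<and> the_lower_cover T p = the_lower_cover T q)"

definition colored_tree :: "('p, 'm) gorder_scheme \<Rightarrow> ('p \<times> 'p) set \<Rightarrow> bool" where
  "colored_tree T C \<longleftrightarrow> tree T \<and> coloring T C"

definition MT :: "('p, 'm) gorder_scheme \<Rightarrow> ('p \<times> 'p) set \<Rightarrow> ('p \<times> 'p set) set" where
  "MT T C = {(p, C `` {q}) | p q. lower_cover T p q}"

definition MT_at :: "('p, 'm) gorder_scheme \<Rightarrow> ('p \<times> 'p) set \<Rightarrow> 'p \<Rightarrow> 'p set set" where
  "MT_at T C p = {C `` {q} | q. lower_cover T p q}"


section \<open>The vector space of a colored tree\<close>

definition fscale :: "'f \<Rightarrow> ('p \<Rightarrow>\<^sub>0 'f) \<Rightarrow> ('p \<Rightarrow>\<^sub>0 'f::division_ring)" where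
  "fscale a x = Poly_Mapping.map ((*) a) x"

definition dot :: "'p \<Rightarrow> ('p \<Rightarrow>\<^sub>0 'f::division_ring)" where
  "dot p = Poly_Mapping.single p 1"

definition free_space :: "('p, 'm) gorder_scheme \<Rightarrow> ('p \<Rightarrow>\<^sub>0 'f::division_ring) set" where
  "free_space T = {x. Poly_Mapping.keys x \<subseteq> carrier T}"

definition free_pos ::
    "('p, 'm) gorder_scheme \<Rightarrow> ('p \<Rightarrow>\<^sub>0 'f::{division_ring,linordered_ring_strict}) set" where
  "free_pos T = {x \<in> free_space T. \<forall>p\<in>carrier T. Poly_Mapping.lookup x p \<ge> 0}"

definition step1 :: "('p, 'm) gorder_scheme \<Rightarrow> ('p \<times> 'p) set \<Rightarrow>
    ('p \<Rightarrow>\<^sub>0 'f::{division_ring,linordered_ring_strict}) \<Rightarrow> ('p \<Rightarrow>\<^sub>0 'f) \<Rightarrow> bool" where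
  "step1 T C x y \<longleftrightarrow> x \<in> free_pos T \<and> y \<in> free_pos T \<and>
     (\<exists>(p, I)\<in>MT T C. \<exists>l\<ge>0. \<exists>z\<in>free_pos T.
        x = fscale (l / of_nat (card I)) (\<Sum>q\<in>I. dot q) + z \<and> y = fscale l (dot p) + z)"

definition tree_equiv :: "('p, 'm) gorder_scheme \<Rightarrow> ('p \<times> 'p) set \<Rightarrow>
    ('p \<Rightarrow>\<^sub>0 'f::{division_ring,linordered_ring_strict}) \<Rightarrow> ('p \<Rightarrow>\<^sub>0 'f) \<Rightarrow> bool" where
  "tree_equiv T C x y \<longleftrightarrow> (\<exists>u\<in>free_pos T. (step1 T C)\<^sup>*\<^sup>* x u \<and> (step1 T C)\<^sup>*\<^sup>* y u)"

definition NT :: "('p, 'm) gorder_scheme \<Rightarrow> ('p \<times> 'p) set \<Rightarrow>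
    ('p \<Rightarrow>\<^sub>0 'f::{division_ring,linordered_ring_strict}) set" where
  "NT T C = {x - y | x y. x \<in> free_pos T \<and> y \<in> free_pos T \<and> tree_equiv T C x y}"

text \<open>The quotient of \<open>free_space T\<close> by \<open>NT T C\<close>: the vectors are the cosets \<open>x +o NT T C\<close>, the sum
  of cosets is their elementwise sum, and \<open>fscale a ` X + NT T C\<close> is the coset of \<open>fscale a x\<close>
  for \<open>x \<in> X\<close> (also for \<open>a = 0\<close>).\<close>

definition VT :: "('p, 'm) gorder_scheme \<Rightarrow> ('p \<times> 'p) set \<Rightarrow>
    ('f::{division_ring,linordered_ring_strict}, ('p \<Rightarrow>\<^sub>0 'f) set) module" where
  "VT T C = \<lparr>carrier = {x +o NT T C | x. x \<in> free_space T}, mult = undefined, one = undefined,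
     zero = NT T C, add = (+), smult = (\<lambda>a X. fscale a ` X + NT T C)\<rparr>"

definition bar :: "('p, 'm) gorder_scheme \<Rightarrow> ('p \<times> 'p) set \<Rightarrow> 'p \<Rightarrow>
    ('p \<Rightarrow>\<^sub>0 'f::{division_ring,linordered_ring_strict}) set" where
  "bar T C p = dot p +o NT T C"

definition OmegaT :: "('p, 'm) gorder_scheme \<Rightarrow> ('p \<times> 'p) set \<Rightarrow>
    ('p \<Rightarrow>\<^sub>0 'f::{division_ring,linordered_ring_strict}) set set" where
  "OmegaT T C = {bar T C p | p. p \<in> carrier T}"

lemma lookup_fscale: "Poly_Mapping.lookup (fscale a x) p = a * Poly_Mapping.lookup x p"
  by (simp add: fscale_def Poly_Mapping.map.rep_eq when_def)

lemma fscale_simps: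
  "fscale a (x + y) = fscale a x + fscale a y" "fscale a (x - y) = fscale a x - fscale a y"
  "fscale (a + b) x = fscale a x + fscale b x" "fscale (a * b) x = fscale a (fscale b x)"
  "fscale 1 x = x" "fscale (- a) x = - fscale a x" "fscale a 0 = 0"
  by (auto intro!: poly_mapping_eqI
      simp: lookup_fscale lookup_add lookup_minus algebra_simps)

lemma in_free_space: "x \<in> free_space T \<longleftrightarrow> (\<forall>p. p \<notin> carrier T \<longrightarrow> Poly_Mapping.lookup x p = 0)"
  by (auto simp: free_space_def in_keys_iff)

lemma free_space_closed:
  "0 \<in> free_space T" "x \<in> free_space T \<Longrightarrow> y \<in> free_space T \<Longrightarrow> x + y \<in> free_space T"
  "x \<in> free_space T \<Longrightarrow> y \<in> free_space T \<Longrightarrow> x - y \<in> free_space T"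
  "x \<in> free_space T \<Longrightarrow> - x \<in> free_space T" "x \<in> free_space T \<Longrightarrow> fscale a x \<in> free_space T"
  by (auto simp: in_free_space lookup_fscale lookup_add lookup_minus)

lemma free_pos_closed:
  "0 \<in> free_pos T" "x \<in> free_pos T \<Longrightarrow> y \<in> free_pos T \<Longrightarrow> x + y \<in> free_pos T"
  "x \<in> free_pos T \<Longrightarrow> a \<ge> 0 \<Longrightarrow> fscale a x \<in> free_pos T"
  by (auto simp: free_pos_def free_space_closed lookup_fscale lookup_add)

lemma step1I:
  assumes "(p, I) \<in> MT T C" "l \<ge> 0" "z \<in> free_pos T" "x \<in> free_pos T" "y \<in> free_pos T"
    "x = fscale (l / of_nat (card I)) (\<Sum>q\<in>I. dot q) + z" "y = fscale l (dot p) + z"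
  shows "step1 T C x y"
  unfolding step1_def using assms by blast

lemma step1E:
  assumes "step1 T C x y"
  obtains p I l z where "(p, I) \<in> MT T C" "l \<ge> 0" "z \<in> free_pos T" "x \<in> free_pos T" "y \<in> free_pos T"
    "x = fscale (l / of_nat (card I)) (\<Sum>q\<in>I. dot q) + z" "y = fscale l (dot p) + z"
  using assms unfolding step1_def by blast

lemma step1_add:
  assumes "step1 T C x y" "c \<in> free_pos T"
  shows "step1 T C (x + c) (y + c)"
proof (rule step1E[OF assms(1)])
  fix p I l z assume *: "(p, I) \<in> MT T C" "l \<ge> 0" "z \<in> free_pos T" "x \<in> free_pos T" "y \<in> free_pos T"
    "x = fscale (l / of_nat (card I)) (\<Sum>q\<in>I. dot q) + z" "y = fscale l (dot p) + z"
  have "z + c \<in> free_pos T" "x + c \<in> free_pos T" "y + c \<in> free_pos T"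
    using *(3-5) assms(2) by (auto intro: free_pos_closed)
  then show ?thesis
    by (rule step1I[OF *(1,2)]) (simp_all only: *(6,7) add.assoc)
qed

lemma step1_scale:
  assumes "step1 T C x y" "a \<ge> 0"
  shows "step1 T C (fscale a x) (fscale a y)"
proof (rule step1E[OF assms(1)])
  fix p I l z assume *: "(p, I) \<in> MT T C" "l \<ge> 0" "z \<in> free_pos T" "x \<in> free_pos T" "y \<in> free_pos T"
    "x = fscale (l / of_nat (card I)) (\<Sum>q\<in>I. dot q) + z" "y = fscale l (dot p) + z"
  have "a * l \<ge> 0" "fscale a z \<in> free_pos T" "fscale a x \<in> free_pos T" "fscale a y \<in> free_pos T"
    using *(2-5) assms(2) by (auto intro: free_pos_closed)
  then show ?thesis
    by (rule step1I[OF *(1)])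
      (simp_all only: *(6,7) fscale_simps(1,4) flip: times_divide_eq_right)
qed

lemma steps_add:
  assumes "(step1 T C)\<^sup>*\<^sup>* x y" "c \<in> free_pos T"
  shows "(step1 T C)\<^sup>*\<^sup>* (x + c) (y + c)"
  using assms by (induction) (auto intro: rtranclp.rtrancl_into_rtrancl step1_add)

lemma steps_scale:
  assumes "(step1 T C)\<^sup>*\<^sup>* x y" "a \<ge> 0"
  shows "(step1 T C)\<^sup>*\<^sup>* (fscale a x) (fscale a y)"
  using assms by (induction) (auto intro: rtranclp.rtrancl_into_rtrancl step1_scale)

lemma tree_equiv_add:
  assumes "tree_equiv T C x y" "tree_equiv T C x' y'" "x' \<in> free_pos T" "y' \<in> free_pos T"
  shows "tree_equiv T C (x + x') (y + y')"
proof -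
  obtain u u' where u: "u \<in> free_pos T" "(step1 T C)\<^sup>*\<^sup>* x u" "(step1 T C)\<^sup>*\<^sup>* y u"
    and u': "u' \<in> free_pos T" "(step1 T C)\<^sup>*\<^sup>* x' u'" "(step1 T C)\<^sup>*\<^sup>* y' u'"
    using assms by (auto simp: tree_equiv_def)
  have "(step1 T C)\<^sup>*\<^sup>* (x + x') (u + u')" "(step1 T C)\<^sup>*\<^sup>* (y + y') (u + u')"
    using steps_add[OF u(2) assms(3)] steps_add[OF u'(2) u(1)]
      steps_add[OF u(3) assms(4)] steps_add[OF u'(3) u(1)]
    by (auto simp: add.commute)
  then show ?thesis using u u' by (auto simp: tree_equiv_def free_pos_closed)
qed

lemma NT_subspace:
  "NT T C \<subseteq> free_space T" "0 \<in> NT T C"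
  "x \<in> NT T C \<Longrightarrow> y \<in> NT T C \<Longrightarrow> x + y \<in> NT T C" "x \<in> NT T C \<Longrightarrow> fscale a x \<in> NT T C"
proof -
  show "NT T C \<subseteq> free_space T"
    by (auto simp: NT_def free_pos_def free_space_closed)
  show "0 \<in> NT T C"
    by (force simp: NT_def tree_equiv_def intro: free_pos_closed)
  show "x + y \<in> NT T C" if xy: "x \<in> NT T C" "y \<in> NT T C"
  proof -
    obtain a b c d where *: "x = a - b" "y = c - d" "a \<in> free_pos T" "b \<in> free_pos T"
      "c \<in> free_pos T" "d \<in> free_pos T" "tree_equiv T C a b" "tree_equiv T C c d"
      using xy by (auto simp: NT_def)
    have "x + y = (a + c) - (b + d)" using * by simp
    then show ?thesis
      using * tree_equiv_add[of T C a b c d] unfolding NT_def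
      by (blast intro: free_pos_closed)
  qed
  show "fscale a x \<in> NT T C" if x: "x \<in> NT T C"
  proof -
    obtain c d where *: "x = c - d" "c \<in> free_pos T" "d \<in> free_pos T" "tree_equiv T C c d"
      using x by (auto simp: NT_def)
    have sym: "tree_equiv T C d c" using * by (auto simp: tree_equiv_def)
    have pos: "fscale b (c - d) \<in> NT T C" if "c \<in> free_pos T" "d \<in> free_pos T" "tree_equiv T C c d" "b \<ge> 0"
      for b c d
    proof -
      have "tree_equiv T C (fscale b c) (fscale b d)"
        using that(3,4) steps_scale[of T C _ _ b] free_pos_closed(3)[of _ T b]
        unfolding tree_equiv_def by blast
      moreover have "fscale b c \<in> free_pos T" "fscale b d \<in> free_pos T"
        using that by (auto intro: free_pos_closed)
      ultimately show ?thesis unfolding NT_def fscale_simps(2) by blast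
    qed
    show ?thesis
    proof (cases "a \<ge> 0")
      case True
      then show ?thesis using pos * by auto
    next
      case False
      then have "fscale (- a) (d - c) \<in> NT T C" using pos[OF *(3,2) sym, of "- a"] by simp
      moreover have "fscale (- a) (d - c) = fscale a x"
        using * by (simp add: fscale_simps)
      ultimately show ?thesis by simp
    qed
  qed
qed

lemma coset_add:
  fixes x y :: "'p \<Rightarrow>\<^sub>0 'f::{division_ring,linordered_ring_strict}"
  shows "(x +o NT T C) + (y +o NT T C) = (x + y) +o NT T C"
proof -
  have "NT T C + NT T C = (NT T C :: ('p \<Rightarrow>\<^sub>0 'f) set)"
    using NT_subspace(2,3) by (force simp: set_plus_def)
  then show ?thesis by (simp add: set_plus_rearrange)
qed

lemma coset_scale: "fscale a ` (x +o NT T C) + NT T C = fscale a x +o NT T C"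
proof (intro equalityI subsetI)
  fix v assume "v \<in> fscale a ` (x +o NT T C) + NT T C"
  then obtain m n where "v = fscale a (x + m) + n" "m \<in> NT T C" "n \<in> NT T C"
    by (auto simp: set_plus_def elt_set_plus_def)
  then show "v \<in> fscale a x +o NT T C"
    using NT_subspace(3)[OF NT_subspace(4)[of m T C a], of n]
    by (auto simp: fscale_simps elt_set_plus_def add.assoc)
next
  fix v assume "v \<in> fscale a x +o NT T C"
  then obtain n where "v = fscale a (x + 0) + n" "n \<in> NT T C"
    by (auto simp: elt_set_plus_def)
  then show "v \<in> fscale a ` (x +o NT T C) + NT T C"
    using NT_subspace(2)[of T C] unfolding set_plus_def elt_set_plus_def by blast
qed

lemma coset_zero: "0 +o NT T C = NT T C"
  by (simp add: elt_set_plus_def)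

lemma left_vector_space_VT:
  "left_vector_space (VT T C)" (is "left_vector_space ?V")
proof (rule left_vector_space.intro)
  show "abelian_group ?V"
  proof (rule abelian_groupI)
    fix X assume "X \<in> carrier ?V"
    then obtain x where x: "X = x +o NT T C" "x \<in> free_space T" by (auto simp: VT_def)
    have "(- x) +o NT T C \<in> carrier ?V" "((- x) +o NT T C) \<oplus>\<^bsub>?V\<^esub> X = \<zero>\<^bsub>?V\<^esub>"
      using x by (auto simp: VT_def coset_add coset_zero free_space_closed)
    then show "\<exists>Y\<in>carrier ?V. Y \<oplus>\<^bsub>?V\<^esub> X = \<zero>\<^bsub>?V\<^esub>" by blast
    show "\<zero>\<^bsub>?V\<^esub> \<oplus>\<^bsub>?V\<^esub> X = X"
      using coset_add[of 0 T C x] x by (simp add: VT_def coset_zero)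
  next
    show "\<zero>\<^bsub>?V\<^esub> \<in> carrier ?V"
      using coset_zero[of T C] free_space_closed(1)[of T] by (force simp: VT_def)
  next
    fix X Y assume "X \<in> carrier ?V" "Y \<in> carrier ?V"
    then show "X \<oplus>\<^bsub>?V\<^esub> Y \<in> carrier ?V"
      by (fastforce simp: VT_def coset_add intro: free_space_closed)
  qed (simp_all add: VT_def ac_simps)
  show "left_vector_space_axioms ?V"
  proof
    fix X a assume "X \<in> carrier ?V"
    then show "a \<odot>\<^bsub>?V\<^esub> X \<in> carrier ?V"
      by (fastforce simp: VT_def coset_scale intro: free_space_closed)
  qed (clarsimp simp: VT_def coset_scale coset_add; simp only: fscale_simps)+
qed


section \<open>Norms\<close>

definition nonzero :: "('l, 'n) gorder_scheme \<Rightarrow> 'l set" where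
  "nonzero L = {a \<in> carrier L. \<not> least L a (carrier L)}"

definition refines :: "('l, 'n) gorder_scheme \<Rightarrow> 'l set \<Rightarrow> 'l set \<Rightarrow> bool" where
  "refines L X Y \<longleftrightarrow> (\<forall>x\<in>X. \<exists>y\<in>Y. x \<sqsubseteq>\<^bsub>L\<^esub> y)"

text \<open>The join is required to exist, which for nonempty \<open>X\<close> is automatic.  The empty set is never a
  nontrivial join-cover of an element of \<open>nonzero L\<close>.\<close>

definition nontrivial_join_cover :: "('l, 'n) gorder_scheme \<Rightarrow> 'l \<Rightarrow> 'l set \<Rightarrow> bool" where
  "nontrivial_join_cover L a X \<longleftrightarrow> finite X \<and> X \<subseteq> nonzero L \<and>
     (\<exists>s. is_lub L s X \<and> a \<sqsubseteq>\<^bsub>L\<^esub> s) \<and> (\<forall>x\<in>X. \<not> a \<sqsubseteq>\<^bsub>L\<^esub> x)"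

definition valued_norm ::
    "('p, 'm) gorder_scheme \<Rightarrow> ('p \<times> 'p) set \<Rightarrow> ('l, 'n) gorder_scheme \<Rightarrow> ('p \<Rightarrow> 'l) \<Rightarrow> bool" where
  "valued_norm T C L e \<longleftrightarrow> e \<in> carrier T \<rightarrow> nonzero L \<and>
     (\<forall>(p, I)\<in>MT T C. nontrivial_join_cover L (e p) (e ` I)) \<and>
     (\<forall>p\<in>carrier T. \<forall>X. nontrivial_join_cover L (e p) X \<longrightarrow>
        (\<exists>I\<in>MT_at T C p. refines L (e ` I) X))"

definition full_norm :: "('p, 'm) gorder_scheme \<Rightarrow> ('l, 'n) gorder_scheme \<Rightarrow> ('p \<Rightarrow> 'l) \<Rightarrow> bool" where
  "full_norm T L e \<longleftrightarrow> (\<forall>x\<in>carrier L. is_lub L x {a \<in> e ` carrier T. a \<sqsubseteq>\<^bsub>L\<^esub> x})"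

end

theory Submission
  imports Defs
begin

text \<open>
  The relations defining the space say that a node \<open>p\<close> is the barycenter of each color class of its
  upper covers.  A nonnegative vector over the tree is in normal form if it vanishes at some node of
  each color class of non-minimal nodes.  Everything rests on the fact that each class modulo \<open>NT T C\<close>
  of a nonnegative vector contains exactly one nonnegative normal form.

  Existence (\<open>normal_form_exists\<close>): replace, on a color class where the vector is positive, the
  minimum value on the class by the corresponding multiple of the parent.  This trades a node of the
  support for a node that is strictly lower in the tree, so the process stops.  Uniqueness
  (\<open>normal_form_unique\<close>): the difference of two congruent vectors is a finite combination of the
  relations; on a deepest color class that occurs in it, the difference is a nonzero constant, so one
  of the two vectors is positive on the whole class.

  Call a set of nodes step-closed if it contains \<open>p\<close> as soon as it contains some color class of upper
  covers of \<open>p\<close>.  Rewriting a vector supported in a step-closed set \<open>A\<close> does not leave \<open>A\<close>, and the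
  vector \<open>dot p\<close> is normal because color classes of upper covers have at least two elements.  Hence a
  point of the hull of \<open>bar T C ` A\<close> has its normal form supported in \<open>A\<close> (\<open>normal_form_in_conv\<close>).  It
  follows that \<open>bar T C\<close> is injective, that the elements of \<open>Co_rel (VT T C) (OmegaT T C)\<close> are exactly
  the images of step-closed sets, and that \<open>OmegaT T C\<close> is plenary: the least trace whose hull
  contains a point is the step-closure of the support of its normal form.

  This turns the theorem into combinatorics.  The first condition on a norm implies that the sublevel sets
  \<open>{p. e p \<le> x}\<close> are step-closed; the second one implies that every step-closed set containing the
  sublevel sets of \<open>x\<close> and \<open>y\<close> contains that of their join.  Meets are preserved because a sublevel
  set of a meet is an intersection of sublevel sets.  Passing from \<open>\<psi>\<close> to \<open>\<phi>\<close> loses nothing, as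
  \<open>\<psi> x\<close> is the trace of \<open>\<phi> x\<close>.
\<close>

section \<open>Totally ordered division rings\<close>

lemma ordered_ring_zero_less_one: "(0::'f::{division_ring,linordered_ring_strict}) < 1"
  using zero_le_square[of "1::'f"] by (simp add: less_le)

lemma ordered_ring_zero_le_one: "(0::'f::{division_ring,linordered_ring_strict}) \<le> 1"
  using ordered_ring_zero_less_one by (rule less_imp_le)

lemma ordered_ring_of_nat_pos:
  "0 < n \<Longrightarrow> (0::'f::{division_ring,linordered_ring_strict}) < of_nat n"
proof (induction n)
  case (Suc n)
  then show ?case
    using ordered_ring_zero_less_one[where 'f='f] by (cases "n = 0") (auto intro: add_pos_pos)
qed simp

lemma ordered_ring_inverse_pos:
  fixes a :: "'f::{division_ring,linordered_ring_strict}"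
  assumes "0 < a"
  shows "0 < inverse a"
proof (rule ccontr)
  assume "\<not> 0 < inverse a"
  then have "a * inverse a \<le> 0"
    using assms by (intro mult_nonneg_nonpos) auto
  then show False
    using assms ordered_ring_zero_less_one[where 'f='f] by simp
qed

section \<open>Finitely supported vectors\<close>

definition mass :: "('p \<Rightarrow>\<^sub>0 'f::comm_monoid_add) \<Rightarrow> 'f" where
  "mass x = Sum_any (Poly_Mapping.lookup x)"

lemma lookup_dot: "Poly_Mapping.lookup (dot p) q = (if q = p then 1 else 0)"
  by (simp add: dot_def lookup_single when_def)

lemma lookup_sum_dot:
  "finite I \<Longrightarrow> Poly_Mapping.lookup (\<Sum>q\<in>I. dot q) r = (if r \<in> I then 1 else 0)"
  by (simp add: lookup_sum lookup_dot)

lemma mass_add: "mass (x + y) = mass x + mass y"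
  by (simp add: mass_def lookup_add Sum_any.distrib)

lemma mass_fscale: "mass (fscale a x) = a * mass x"
  by (simp add: mass_def lookup_fscale Sum_any_right_distrib)

lemma mass_dot: "mass (dot p) = 1"
proof -
  have "mass (dot p) = (\<Sum>q. (1 when p = q))"
    by (simp add: mass_def dot_def lookup_single)
  then show ?thesis
    by (simp only: Sum_any_when_equal')
qed

lemma mass_sum_dot: "finite I \<Longrightarrow> mass (\<Sum>q\<in>I. dot q) = of_nat (card I)"
proof (induction rule: finite_induct)
  case empty
  then show ?case by (simp add: mass_def)
qed (simp add: mass_add mass_dot)

lemma free_pos_iff: "x \<in> free_pos T \<longleftrightarrow> x \<in> free_space T \<and> (\<forall>p. Poly_Mapping.lookup x p \<ge> 0)"
  by (auto simp: free_pos_def in_free_space)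

lemma dot_in_free_pos: "p \<in> carrier T \<Longrightarrow> dot p \<in> free_pos T"
  by (auto simp: free_pos_iff in_free_space lookup_dot ordered_ring_zero_le_one)

lemma sum_dot_in_free_pos: "finite I \<Longrightarrow> I \<subseteq> carrier T \<Longrightarrow> (\<Sum>q\<in>I. dot q) \<in> free_pos T"
  by (auto simp: free_pos_iff in_free_space lookup_sum_dot ordered_ring_zero_le_one)

section \<open>Convex hulls in the space of a colored tree\<close>

lemma convex_in_conv:
  assumes "left_vector_space V" "X \<subseteq> carrier V"
  shows "convex_in V (conv V X)"
proof -
  interpret left_vector_space V by fact
  have "convex_in V (carrier V)"
    by (auto simp: convex_in_def smult_closed)
  then have "conv V X \<subseteq> carrier V"
    using assms(2) unfolding conv_def by (rule hull_minimal[rotated])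
  then show ?thesis
    unfolding conv_def hull_def convex_in_def by blast
qed

lemma coset_eq_iff_diff_NT:
  fixes x y :: "'p \<Rightarrow>\<^sub>0 'f::{division_ring,linordered_ring_strict}"
  shows "x +o NT T C = y +o NT T C \<longleftrightarrow> x - y \<in> NT T C"
    (is "_ \<longleftrightarrow> _ \<in> ?N")
proof
  assume "x +o NT T C = y +o NT T C"
  moreover have "x \<in> x +o NT T C"
    using NT_subspace(2)[of T C] by (auto simp: elt_set_plus_def intro!: bexI[of _ 0])
  ultimately show "x - y \<in> NT T C"
    by (auto simp: elt_set_plus_def)
next
  assume d: "x - y \<in> NT T C"
  have "x +o NT T C = y +o ((x - y) +o NT T C)"
    by (simp add: set_plus_rearrange2)
  also have "(x - y) +o NT T C = NT T C"
  proof (intro equalityI subsetI)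
    fix v assume "v \<in> (x - y) +o NT T C"
    then show "v \<in> NT T C"
      using d NT_subspace(3) by (auto simp: elt_set_plus_def)
  next
    fix v assume v: "v \<in> ?N"
    have "fscale (- 1) (x - y) + v \<in> NT T C"
      by (intro NT_subspace(3,4) d v)
    then show "v \<in> (x - y) +o NT T C"
      by (auto simp: elt_set_plus_def fscale_simps intro!: bexI[of _ "fscale (- 1) (x - y) + v"])
  qed
  finally show "x +o NT T C = y +o NT T C" .
qed

lemma VT_combination:
  "(a \<odot>\<^bsub>VT T C\<^esub> (x +o NT T C)) \<oplus>\<^bsub>VT T C\<^esub> (b \<odot>\<^bsub>VT T C\<^esub> (y +o NT T C))
    = (fscale a x + fscale b y) +o NT T C"
  by (simp add: VT_def coset_scale coset_add)

text \<open>
  The two-point definition of convexity yields all finite convex combinations: split off one node \<open>p\<close>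
  of weight \<open>t < 1\<close> and rescale the rest by \<open>inverse (1 - t)\<close>.
\<close>

lemma convex_contains_combination:
  fixes W :: "('p \<Rightarrow>\<^sub>0 'f::{division_ring,linordered_ring_strict}) set set"
  assumes W: "convex_in (VT T C) W" "\<And>p. p \<in> A \<Longrightarrow> bar T C p \<in> W"
    and v: "v \<in> free_pos T" "mass v = 1" "Poly_Mapping.keys v \<subseteq> A"
  shows "v +o NT T C \<in> W"
  using v
proof (induction "card (Poly_Mapping.keys v)" arbitrary: v rule: less_induct)
  case less
  have v_ge: "Poly_Mapping.lookup v q \<ge> 0" for q
    using less.prems by (simp add: free_pos_iff)
  have "Poly_Mapping.keys v \<noteq> {}"
    using less.prems(2) by (auto simp: mass_def)
  then obtain p where p: "p \<in> Poly_Mapping.keys v" by blast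
  define t where "t = Poly_Mapping.lookup v p"
  define r where "r = v - fscale t (dot p)"
  have lr: "Poly_Mapping.lookup r q = (if q = p then 0 else Poly_Mapping.lookup v q)" for q
    by (simp add: r_def lookup_minus lookup_fscale lookup_dot t_def)
  have kr: "Poly_Mapping.keys r = Poly_Mapping.keys v - {p}"
    by (auto simp: in_keys_iff lr split: if_splits)
  have r_pos: "r \<in> free_pos T"
    using less.prems(1) by (auto simp: free_pos_iff in_free_space lr)
  have v_eq: "v = fscale t (dot p) + r"
    by (simp add: r_def)
  have mass_r: "mass r = 1 - t"
    using less.prems(2) by (simp add: v_eq mass_add mass_fscale mass_dot algebra_simps)
  have p': "dot p +o NT T C \<in> W"
    using W(2)[of p] p less.prems(3) by (auto simp: bar_def)
  show ?case
  proof (cases "Poly_Mapping.keys r = {}")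
    case True
    then have "r = 0" by simp
    then have "v = dot p"
      using mass_r v_eq by (simp add: mass_def fscale_simps)
    then show ?thesis using p' by simp
  next
    case False
    then obtain q where q: "q \<in> Poly_Mapping.keys r" by blast
    have "mass r = (\<Sum>s\<in>Poly_Mapping.keys r. Poly_Mapping.lookup r s)"
      unfolding mass_def by (intro Sum_any.expand_superset) (auto simp: in_keys_iff)
    also have "\<dots> > 0"
      using q r_pos by (intro sum_pos2[of _ q]) (auto simp: free_pos_iff in_keys_iff less_le)
    finally have t1: "0 < 1 - t"
      using mass_r by simp
    define w where "w = fscale (inverse (1 - t)) r"
    have w: "w \<in> free_pos T" "mass w = 1"
      using r_pos t1 ordered_ring_inverse_pos[OF t1] mass_r
      by (auto simp: w_def mass_fscale intro: free_pos_closed)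
    have kw: "Poly_Mapping.keys w \<subseteq> Poly_Mapping.keys v - {p}"
      unfolding kr[symmetric] by (auto simp: w_def in_keys_iff lookup_fscale)
    then have "card (Poly_Mapping.keys w) < card (Poly_Mapping.keys v)"
      using p by (intro psubset_card_mono) auto
    then have "w +o NT T C \<in> W"
      using less.hyps w kw less.prems(3) by blast
    then have "(t \<odot>\<^bsub>VT T C\<^esub> (dot p +o NT T C)) \<oplus>\<^bsub>VT T C\<^esub> ((1 - t) \<odot>\<^bsub>VT T C\<^esub> (w +o NT T C)) \<in> W"
      using W(1) p' t1 v_ge[of p] unfolding convex_in_def t_def by force
    moreover have "fscale (1 - t) w = r"
      using t1 by (simp add: w_def flip: fscale_simps(4)) (simp add: fscale_simps)
    ultimately show ?thesis
      by (simp add: VT_combination flip: v_eq)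
  qed
qed

lemma conv_bar:
  fixes A :: "'p set"
  assumes "A \<subseteq> carrier T"
  shows "conv (VT T C) (bar T C ` A :: ('p \<Rightarrow>\<^sub>0 'f::{division_ring,linordered_ring_strict}) set set) =
    {v +o NT T C | v. v \<in> free_pos T \<and> mass v = 1 \<and> Poly_Mapping.keys v \<subseteq> A}"
    (is "_ = ?R")
proof
  have "convex_in (VT T C) ?R"
    unfolding convex_in_def
  proof (intro conjI ballI allI impI)
    show "?R \<subseteq> carrier (VT T C)"
      by (auto simp: VT_def free_pos_iff)
    fix X Y and a b :: 'f
    assume X: "X \<in> ?R" and Y: "Y \<in> ?R" and ab: "0 \<le> a \<and> 0 \<le> b \<and> a + b = 1"
    obtain x where x: "X = x +o NT T C" "x \<in> free_pos T" "mass x = 1" "Poly_Mapping.keys x \<subseteq> A"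
      using X by blast
    obtain y where y: "Y = y +o NT T C" "y \<in> free_pos T" "mass y = 1" "Poly_Mapping.keys y \<subseteq> A"
      using Y by blast
    have "fscale a x + fscale b y \<in> free_pos T"
      using x y ab by (intro free_pos_closed) auto
    moreover have "mass (fscale a x + fscale b y) = 1"
      using x y ab by (simp add: mass_add mass_fscale)
    moreover have "Poly_Mapping.keys (fscale a x + fscale b y) \<subseteq> A"
    proof
      fix q assume "q \<in> Poly_Mapping.keys (fscale a x + fscale b y)"
      then have "q \<in> Poly_Mapping.keys x \<or> q \<in> Poly_Mapping.keys y"
        by (auto simp: in_keys_iff lookup_add lookup_fscale)
      then show "q \<in> A" using x(4) y(4) by blast
    qed
    ultimately show "(a \<odot>\<^bsub>VT T C\<^esub> X) \<oplus>\<^bsub>VT T C\<^esub> (b \<odot>\<^bsub>VT T C\<^esub> Y) \<in> ?R"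
      unfolding x(1) y(1) VT_combination by blast
  qed
  moreover have "bar T C ` A \<subseteq> ?R"
  proof clarify
    fix p assume "p \<in> A"
    then have "(dot p :: 'p \<Rightarrow>\<^sub>0 'f) \<in> free_pos T"
      using assms by (intro dot_in_free_pos) auto
    moreover have "Poly_Mapping.keys (dot p :: 'p \<Rightarrow>\<^sub>0 'f) \<subseteq> A"
      using \<open>p \<in> A\<close> by (simp add: dot_def)
    ultimately show "\<exists>v. bar T C p = v +o NT T C \<and> (v :: 'p \<Rightarrow>\<^sub>0 'f) \<in> free_pos T \<and> mass v = 1 \<and> Poly_Mapping.keys v \<subseteq> A"
      by (intro exI[of _ "dot p"] conjI bar_def mass_dot)
  qed
  ultimately show "conv (VT T C) (bar T C ` A) \<subseteq> ?R"
    unfolding conv_def by (rule hull_minimal[rotated])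
  show "?R \<subseteq> conv (VT T C) (bar T C ` A)"
  proof clarify
    fix v :: "'p \<Rightarrow>\<^sub>0 'f"
    assume v: "v \<in> free_pos T" "mass v = 1" "Poly_Mapping.keys v \<subseteq> A"
    have sub: "bar T C ` A \<subseteq> carrier (VT T C :: ('f, _) module)"
      using assms dot_in_free_pos by (fastforce simp: VT_def bar_def free_pos_iff)
    show "v +o NT T C \<in> conv (VT T C) (bar T C ` A)"
    proof (rule convex_contains_combination[OF convex_in_conv[OF left_vector_space_VT sub] _ v])
      show "bar T C p \<in> conv (VT T C) (bar T C ` A)" if "p \<in> A" for p
        unfolding conv_def using that by (intro hull_inc) simp
    qed
  qed
qed

lemma OmegaT_image: "OmegaT T C = bar T C ` carrier T"
  by (auto simp: OmegaT_def)

lemma OmegaT_subset_carrier: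
  "OmegaT T C \<subseteq> carrier (VT T C :: ('f::{division_ring,linordered_ring_strict}, ('p \<Rightarrow>\<^sub>0 'f) set) module)"
  using dot_in_free_pos by (fastforce simp: OmegaT_def VT_def bar_def free_pos_iff)

section \<open>Colored trees\<close>

definition depth :: "('p, 'm) gorder_scheme \<Rightarrow> 'p \<Rightarrow> nat" where
  "depth T p = card {r \<in> carrier T. r \<sqsubseteq>\<^bsub>T\<^esub> p}"

text \<open>
  The images of these sets under \<open>bar T C\<close> turn out to be exactly the traces of convex sets on \<open>OmegaT T C\<close>
  (\<open>bar_image_in_Co_rel\<close>, \<open>Co_rel_OmegaT_cases\<close>).
\<close>

definition step_closed :: "('p, 'm) gorder_scheme \<Rightarrow> ('p \<times> 'p) set \<Rightarrow> 'p set \<Rightarrow> bool" where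
  "step_closed T C A \<longleftrightarrow> (\<forall>(p, I)\<in>MT T C. I \<subseteq> A \<longrightarrow> p \<in> A)"

text \<open>
  For nonnegative vectors: only rewriting steps with parameter 0 are possible.
\<close>

definition normal ::
    "('p, 'm) gorder_scheme \<Rightarrow> ('p \<times> 'p) set \<Rightarrow> ('p \<Rightarrow>\<^sub>0 'f::zero) \<Rightarrow> bool" where
  "normal T C u \<longleftrightarrow> (\<forall>(p, I)\<in>MT T C. \<exists>q\<in>I. Poly_Mapping.lookup u q = 0)"

text \<open>
  The function \<open>c\<close> is a flow on the edges of the tree: \<open>c q\<close> is the amount moved from \<open>q\<close> down to its
  lower cover, it is the same for all members of a color class, and \<open>d\<close> is the net gain at each
  node.  Thus \<open>d\<close> is a finite combination of the relations that define \<open>NT T C\<close>.  Indexing by nodes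
  instead of color classes makes the coefficients an ordinary finitely supported vector.
\<close>

definition flow_of :: "('p, 'm) gorder_scheme \<Rightarrow> ('p \<times> 'p) set \<Rightarrow>
    ('p \<Rightarrow>\<^sub>0 'f) \<Rightarrow> ('p \<Rightarrow>\<^sub>0 'f::ab_group_add) \<Rightarrow> bool" where
  "flow_of T C c d \<longleftrightarrow>
     (\<forall>q\<in>Poly_Mapping.keys c. q \<in> carrier T \<and> \<not> minimal_in T q) \<and>
     (\<forall>q r. (q, r) \<in> C \<longrightarrow> Poly_Mapping.lookup c q = Poly_Mapping.lookup c r) \<and>
     (\<forall>r. Poly_Mapping.lookup d r =
        (\<Sum>q. Poly_Mapping.lookup c q when the_lower_cover T q = r) - Poly_Mapping.lookup c r)"

definition flow_space ::
    "('p, 'm) gorder_scheme \<Rightarrow> ('p \<times> 'p) set \<Rightarrow> ('p \<Rightarrow>\<^sub>0 'f::ab_group_add) set" where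
  "flow_space T C = {d. \<exists>c. flow_of T C c d}"

lemma flow_ofI:
  assumes "\<And>q. q \<in> Poly_Mapping.keys c \<Longrightarrow> q \<in> carrier T \<and> \<not> minimal_in T q"
    and "\<And>q r. (q, r) \<in> C \<Longrightarrow> Poly_Mapping.lookup c q = Poly_Mapping.lookup c r"
    and "\<And>r. Poly_Mapping.lookup d r =
        (\<Sum>q. Poly_Mapping.lookup c q when the_lower_cover T q = r) - Poly_Mapping.lookup c r"
  shows "flow_of T C c d"
  unfolding flow_of_def using assms by blast

lemma flow_ofD:
  assumes "flow_of T C c d"
  shows "q \<in> Poly_Mapping.keys c \<Longrightarrow> q \<in> carrier T \<and> \<not> minimal_in T q"
    and "(q, r) \<in> C \<Longrightarrow> Poly_Mapping.lookup c q = Poly_Mapping.lookup c r"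
    and "Poly_Mapping.lookup d r =
        (\<Sum>q. Poly_Mapping.lookup c q when the_lower_cover T q = r) - Poly_Mapping.lookup c r"
  using assms unfolding flow_of_def by blast+

context
  fixes T :: "('p, 'm) gorder_scheme" and C :: "('p \<times> 'p) set"
  assumes ct: "colored_tree T C"
begin

lemma tree_partial_order: "partial_order T"
  using ct by (simp add: colored_tree_def tree_def)

lemma tree_lless: "p \<sqsubset>\<^bsub>T\<^esub> q \<longleftrightarrow> p \<sqsubseteq>\<^bsub>T\<^esub> q \<and> p \<noteq> q"
proof -
  interpret partial_order T by (rule tree_partial_order)
  show ?thesis by (simp add: lless_def eq_is_equal)
qed

lemma lower_cover_unique:
  assumes "lower_cover T p q" "lower_cover T p' q"
  shows "p = p'"
proof -
  have "p \<sqsubseteq>\<^bsub>T\<^esub> p' \<or> p' \<sqsubseteq>\<^bsub>T\<^esub> p"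
    using ct assms unfolding colored_tree_def tree_def lower_cover_def tree_lless by blast
  then show ?thesis
    using assms unfolding lower_cover_def tree_lless by blast
qed

lemma the_lower_cover_eq: "lower_cover T p q \<Longrightarrow> the_lower_cover T q = p"
  unfolding the_lower_cover_def using lower_cover_unique by blast

lemma finite_principal: "p \<in> carrier T \<Longrightarrow> finite {r \<in> carrier T. r \<sqsubseteq>\<^bsub>T\<^esub> p}"
  using ct by (simp add: colored_tree_def tree_def)

lemma depth_strict_mono:
  assumes "p \<in> carrier T" "q \<in> carrier T" "p \<sqsubset>\<^bsub>T\<^esub> q"
  shows "depth T p < depth T q"
proof -
  interpret partial_order T by (rule tree_partial_order)
  have "{r \<in> carrier T. r \<sqsubseteq>\<^bsub>T\<^esub> p} \<subseteq> {r \<in> carrier T. r \<sqsubseteq>\<^bsub>T\<^esub> q}"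
    using assms tree_lless by (auto intro: le_trans)
  moreover have "q \<in> {r \<in> carrier T. r \<sqsubseteq>\<^bsub>T\<^esub> q} - {r \<in> carrier T. r \<sqsubseteq>\<^bsub>T\<^esub> p}"
    using assms tree_lless by (auto intro: le_antisym)
  ultimately show ?thesis
    unfolding depth_def by (intro psubset_card_mono finite_principal assms(2)) blast
qed

lemma lower_cover_the_lower_cover:
  assumes "q \<in> carrier T" "\<not> minimal_in T q"
  shows "lower_cover T (the_lower_cover T q) q"
proof -
  interpret partial_order T by (rule tree_partial_order)
  let ?S = "{r \<in> carrier T. r \<sqsubset>\<^bsub>T\<^esub> q}"
  have fin: "finite ?S"
    by (rule finite_subset[OF _ finite_principal[OF assms(1)]]) (auto simp: tree_lless)
  have ne: "?S \<noteq> {}"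
    using assms by (auto simp: minimal_in_def)
  obtain p where p: "p \<in> ?S" "\<And>r. r \<in> ?S \<Longrightarrow> depth T r \<le> depth T p"
    using Max_in[of "depth T ` ?S"] Max_ge[of "depth T ` ?S"] fin ne by fastforce
  then have "lower_cover T p q"
    using depth_strict_mono assms(1) unfolding lower_cover_def by fastforce
  then show ?thesis
    using the_lower_cover_eq by simp
qed

lemma depth_lower_cover: "lower_cover T p q \<Longrightarrow> depth T p < depth T q"
  by (simp add: lower_cover_def depth_strict_mono)

lemma
  shows coloring_sym: "(p, q) \<in> C \<Longrightarrow> (q, p) \<in> C"
    and coloring_trans: "(p, q) \<in> C \<Longrightarrow> (q, r) \<in> C \<Longrightarrow> (p, r) \<in> C"
    and coloring_carrier: "(p, q) \<in> C \<Longrightarrow> p \<in> carrier T \<and> q \<in> carrier T"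
  using ct unfolding colored_tree_def coloring_def equiv_def refl_on_def sym_def trans_def
  by blast+

lemma coloring_lower_cover:
  assumes "lower_cover T p q" "(q, r) \<in> C"
  shows "lower_cover T p r"
proof -
  have "\<not> minimal_in T q"
    using assms by (auto simp: lower_cover_def minimal_in_def)
  then have "\<not> minimal_in T r" "the_lower_cover T q = the_lower_cover T r"
    using ct assms unfolding colored_tree_def coloring_def by blast+
  then show ?thesis
    using lower_cover_the_lower_cover[of r] the_lower_cover_eq[OF assms(1)]
      coloring_carrier[OF assms(2)] by simp
qed

lemma MT_facts:
  assumes "(p, I) \<in> MT T C"
  shows "p \<in> carrier T" "I \<subseteq> carrier T" "finite I" "card I \<ge> 2" "p \<notin> I"
    and "\<And>q. q \<in> I \<Longrightarrow> lower_cover T p q"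
    and "\<And>q r. q \<in> I \<Longrightarrow> (q, r) \<in> C \<longleftrightarrow> r \<in> I"
proof -
  obtain q where q: "I = C `` {q}" "lower_cover T p q"
    using assms by (auto simp: MT_def)
  then have "q \<in> carrier T" "\<not> minimal_in T q"
    by (auto simp: lower_cover_def minimal_in_def)
  then show "finite I" "card I \<ge> 2"
    using ct q unfolding colored_tree_def coloring_def by auto
  show "p \<in> carrier T"
    using q by (auto simp: lower_cover_def)
  show "I \<subseteq> carrier T"
    using q coloring_carrier by auto
  show lc: "lower_cover T p q" if "q \<in> I" for q
    using that q coloring_lower_cover by auto
  show "p \<notin> I"
    using lc depth_lower_cover by fastforce
  show "(q, r) \<in> C \<longleftrightarrow> r \<in> I" if "q \<in> I" for q r
    using that q coloring_sym coloring_trans by blast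
qed

lemma MT_class:
  assumes "q \<in> carrier T" "\<not> minimal_in T q"
  shows "(the_lower_cover T q, C `` {q}) \<in> MT T C"
  using lower_cover_the_lower_cover[OF assms] by (auto simp: MT_def)

section \<open>Existence of normal forms\<close>

text \<open>
  A color class of upper covers has at least two elements, so \<open>dot p\<close> vanishes at one of them.
\<close>

lemma normal_dot: "normal T C (dot p)"
  unfolding normal_def
proof (clarify)
  fix q I assume I: "(q, I) \<in> MT T C"
  then have "\<not> I \<subseteq> {p}"
    using MT_facts(3,4)[OF I] card_mono[of "{p}" I] by auto
  then show "\<exists>r\<in>I. Poly_Mapping.lookup (dot p) r = 0"
    by (auto simp: lookup_dot)
qed

text \<open>
  A step with \<open>l > 0\<close> can only be performed when the whole class \<open>I\<close> lies in the support, because no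
  coordinate of the remainder is negative.  A step with \<open>l = 0\<close> does nothing.
\<close>

lemma step_keys:
  fixes x y :: "'p \<Rightarrow>\<^sub>0 'f::{division_ring,linordered_ring_strict}"
  assumes "step1 T C x y" "step_closed T C A" "Poly_Mapping.keys x \<subseteq> A"
  shows "Poly_Mapping.keys y \<subseteq> A"
  using assms(1)
proof (rule step1E)
  fix p I l z
  assume *: "(p, I) \<in> MT T C" "l \<ge> 0" "z \<in> free_pos T"
    "x = fscale (l / of_nat (card I)) (\<Sum>q\<in>I. dot q) + z" "y = fscale l (dot p) + z"
  note I = MT_facts[OF *(1)]
  show ?thesis
  proof (cases "l = 0")
    case True
    then have "y = x"
      using * by (intro poly_mapping_eqI) (simp add: lookup_fscale lookup_add)
    then show ?thesis using assms by simp
  next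
    case False
    then have l: "l > 0" "l / of_nat (card I) > 0"
      using *(2) I(4) ordered_ring_of_nat_pos[of "card I", where 'f='f]
      by (auto simp: divide_inverse intro!: mult_pos_pos ordered_ring_inverse_pos)
    have lx: "Poly_Mapping.lookup x r = (if r \<in> I then l / of_nat (card I) else 0) + Poly_Mapping.lookup z r" for r
      by (simp add: *(4) lookup_add lookup_fscale lookup_sum_dot I)
    have z: "Poly_Mapping.lookup z r \<ge> 0" for r
      using *(3) by (simp add: free_pos_iff)
    have xpos: "l / of_nat (card I) + Poly_Mapping.lookup z r \<noteq> 0" for r
      using add_pos_nonneg[OF l(2) z[of r]] by simp
    then have "I \<subseteq> Poly_Mapping.keys x"
      by (simp add: subset_iff in_keys_iff lx)
    then have "p \<in> A"
      using assms *(1) unfolding step_closed_def by blast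
    moreover have "Poly_Mapping.keys z \<subseteq> Poly_Mapping.keys x"
      using xpos by (auto simp: in_keys_iff lx split: if_splits)
    moreover have "Poly_Mapping.keys y \<subseteq> insert p (Poly_Mapping.keys z)"
      by (auto simp: *(5) in_keys_iff lookup_add lookup_fscale lookup_dot split: if_splits)
    ultimately show ?thesis
      using assms(3) by blast
  qed
qed

lemma steps_keys:
  assumes "(step1 T C)\<^sup>*\<^sup>* x y" "step_closed T C A" "Poly_Mapping.keys x \<subseteq> A"
  shows "Poly_Mapping.keys y \<subseteq> A"
  using assms(1,3) by induction (auto dest: step_keys[OF _ assms(2)])

lemma step_mass:
  fixes x y :: "'p \<Rightarrow>\<^sub>0 'f::{division_ring,linordered_ring_strict}"
  assumes "step1 T C x y"
  shows "mass y = mass x"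
  using assms
proof (rule step1E)
  fix p I l z
  assume *: "(p, I) \<in> MT T C"
    "x = fscale (l / of_nat (card I)) (\<Sum>q\<in>I. dot q) + z" "y = fscale l (dot p) + z"
  note I = MT_facts[OF *(1)]
  have "of_nat (card I) \<noteq> (0::'f)"
    using ordered_ring_of_nat_pos[of "card I", where 'f='f] I(4) by auto
  then have "l / of_nat (card I) * of_nat (card I) = l"
    by (simp add: divide_inverse mult.assoc)
  then show ?thesis
    by (simp only: *(2,3) mass_add mass_fscale mass_dot mass_sum_dot I(3) mult_1_right)
qed

lemma steps_mass: "(step1 T C)\<^sup>*\<^sup>* x y \<Longrightarrow> mass y = mass x"
  by (induction rule: rtranclp_induct) (auto dest: step_mass)

lemma steps_free_pos: "(step1 T C)\<^sup>*\<^sup>* x y \<Longrightarrow> x \<in> free_pos T \<Longrightarrow> y \<in> free_pos T"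
  by (induction rule: rtranclp_induct) (auto simp: step1_def)

lemma steps_NT:
  assumes "(step1 T C)\<^sup>*\<^sup>* x y" "x \<in> free_pos T"
  shows "x - y \<in> NT T C"
  using assms steps_free_pos[OF assms] unfolding NT_def tree_equiv_def by blast

text \<open>
  The process terminates because the sum of the depths of the supporting nodes decreases: a step that
  removes the minimum on a class deletes a node of the class from the support and adds at most the
  common lower cover, which has smaller depth.
\<close>

lemma normal_form_exists:
  fixes v :: "'p \<Rightarrow>\<^sub>0 'f::{division_ring,linordered_ring_strict}"
  assumes "v \<in> free_pos T"
  shows "\<exists>u. (step1 T C)\<^sup>*\<^sup>* v u \<and> normal T C u"
  using assms
proof (induction "\<Sum>q\<in>Poly_Mapping.keys v. depth T q" arbitrary: v rule: less_induct)
  case less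
  show ?case
  proof (cases "normal T C v")
    case False
    then obtain p I where pI: "(p, I) \<in> MT T C" "\<And>q. q \<in> I \<Longrightarrow> Poly_Mapping.lookup v q \<noteq> 0"
      by (auto simp: normal_def)
    note I = MT_facts[OF pI(1)]
    define m where "m = Min (Poly_Mapping.lookup v ` I)"
    have "I \<noteq> {}" using I(4) by auto
    have "m \<in> Poly_Mapping.lookup v ` I"
      unfolding m_def using I(3) \<open>I \<noteq> {}\<close> by (intro Min_in) auto
    then obtain q0 where q0: "q0 \<in> I" "m = Poly_Mapping.lookup v q0"
      by blast
    have m_le: "m \<le> Poly_Mapping.lookup v q" if "q \<in> I" for q
      unfolding m_def using that I(3) by simp
    have v_ge: "Poly_Mapping.lookup v q \<ge> 0" for q
      using less.prems by (simp add: free_pos_iff)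
    have "m > 0"
      using q0 pI(2) v_ge[of q0] by (simp add: less_le)
    \<comment> \<open>A step with parameter \<open>l\<close> takes \<open>l / card I\<close> away from each member of \<open>I\<close>; this choice takes the minimum.\<close>
    define l where "l = m * of_nat (card I)"
    have card_pos: "(0::'f) < of_nat (card I)"
      using I(4) by (intro ordered_ring_of_nat_pos) simp
    have l_ge: "l \<ge> 0"
      unfolding l_def using \<open>m > 0\<close> card_pos by simp
    have lm: "l / of_nat (card I) = m"
      unfolding l_def using card_pos by (simp add: divide_inverse mult.assoc)
    define z where "z = v - fscale m (\<Sum>q\<in>I. dot q)"
    define y where "y = fscale l (dot p) + z"
    have lz: "Poly_Mapping.lookup z r = Poly_Mapping.lookup v r - (if r \<in> I then m else 0)" for r
      by (simp add: z_def lookup_minus lookup_fscale lookup_sum_dot I(3))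
    have z: "z \<in> free_pos T"
      using less.prems I(2) m_le
      by (auto simp: free_pos_iff lz in_free_space)
    have y: "y \<in> free_pos T"
      unfolding y_def using l_ge z I(1) by (intro free_pos_closed dot_in_free_pos) auto
    have step: "step1 T C v y"
      by (rule step1I[OF pI(1) l_ge z less.prems y]) (simp_all add: lm z_def y_def)
    have "Poly_Mapping.keys z \<subseteq> Poly_Mapping.keys v - {q0}"
      using q0 pI(2) by (auto simp: in_keys_iff lz split: if_splits)
    then have ky: "Poly_Mapping.keys y \<subseteq> insert p (Poly_Mapping.keys v - {q0})"
      by (auto simp: y_def in_keys_iff lookup_add lookup_fscale lookup_dot)
    have "(\<Sum>q\<in>Poly_Mapping.keys y. depth T q) \<le> (\<Sum>q\<in>insert p (Poly_Mapping.keys v - {q0}). depth T q)"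
      using ky by (intro sum_mono2) auto
    also have "\<dots> \<le> depth T p + (\<Sum>q\<in>Poly_Mapping.keys v - {q0}. depth T q)"
      by (cases "p \<in> Poly_Mapping.keys v - {q0}") (auto simp: insert_absorb)
    also have "\<dots> < depth T q0 + (\<Sum>q\<in>Poly_Mapping.keys v - {q0}. depth T q)"
      using depth_lower_cover[OF I(6)[OF q0(1)]] by simp
    also have "\<dots> = (\<Sum>q\<in>Poly_Mapping.keys v. depth T q)"
      using pI(2)[OF q0(1)] by (subst (2) sum.remove[of _ q0]) (auto simp: in_keys_iff)
    finally show ?thesis
      using less.hyps[OF _ y] step by (meson converse_rtranclp_into_rtranclp)
  qed auto
qed

section \<open>Uniqueness of normal forms\<close>

lemma flow_of_diff:
  fixes d d' :: "'p \<Rightarrow>\<^sub>0 'f::ab_group_add"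
  assumes c: "flow_of T C c d" and c': "flow_of T C c' d'"
  shows "flow_of T C (c - c') (d - d')"
proof (rule flow_ofI)
  show "q \<in> carrier T \<and> \<not> minimal_in T q" if "q \<in> Poly_Mapping.keys (c - c')" for q
    using that flow_ofD(1)[OF c] flow_ofD(1)[OF c'] keys_diff[of c c'] by blast
  show "Poly_Mapping.lookup (c - c') q = Poly_Mapping.lookup (c - c') r" if "(q, r) \<in> C" for q r
    using flow_ofD(2)[OF c that] flow_ofD(2)[OF c' that] by (simp add: lookup_minus)
  fix r
  have fin: "finite {q. (Poly_Mapping.lookup b q when the_lower_cover T q = r) \<noteq> 0}"
    for b :: "'p \<Rightarrow>\<^sub>0 'f"
    by (rule finite_subset[OF _ finite_keys[of b]]) (auto simp: in_keys_iff)
  have "(\<Sum>q. Poly_Mapping.lookup c q when the_lower_cover T q = r) =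
      (\<Sum>q. Poly_Mapping.lookup (c - c') q when the_lower_cover T q = r) +
      (\<Sum>q. Poly_Mapping.lookup c' q when the_lower_cover T q = r)"
    by (subst Sum_any.distrib[OF fin fin, symmetric])
      (simp add: lookup_minus flip: when_add_distrib)
  then show "Poly_Mapping.lookup (d - d') r =
      (\<Sum>q. Poly_Mapping.lookup (c - c') q when the_lower_cover T q = r) - Poly_Mapping.lookup (c - c') r"
    unfolding lookup_minus flow_ofD(3)[OF c] flow_ofD(3)[OF c'] by (simp add: algebra_simps)
qed

lemma flow_space_diff: "d \<in> flow_space T C \<Longrightarrow> d' \<in> flow_space T C \<Longrightarrow> d - d' \<in> flow_space T C"
  unfolding flow_space_def using flow_of_diff by blast

text \<open>
  A step is the flow that sends \<open>l / card I\<close> from each member of \<open>I\<close> to \<open>p\<close>; the amounts add up to \<open>l\<close>.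
\<close>

lemma step_flow_space:
  fixes x y :: "'p \<Rightarrow>\<^sub>0 'f::{division_ring,linordered_ring_strict}"
  assumes "step1 T C x y"
  shows "y - x \<in> flow_space T C"
  using assms
proof (rule step1E)
  fix p I l z
  assume *: "(p, I) \<in> MT T C"
    "x = fscale (l / of_nat (card I)) (\<Sum>q\<in>I. dot q) + z" "y = fscale l (dot p) + z"
  note I = MT_facts[OF *(1)]
  define c where "c = fscale (l / of_nat (card I)) (\<Sum>q\<in>I. dot q)"
  have lc: "Poly_Mapping.lookup c q = (if q \<in> I then l / of_nat (card I) else 0)" for q
    by (simp add: c_def lookup_fscale lookup_sum_dot I(3))
  have nz: "of_nat (card I) \<noteq> (0::'f)"
    using ordered_ring_of_nat_pos[of "card I", where 'f='f] I(4) by auto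
  have "flow_of T C c (y - x)"
  proof (rule flow_ofI)
    show "q \<in> carrier T \<and> \<not> minimal_in T q" if "q \<in> Poly_Mapping.keys c" for q
      using that I(6)[of q]
      by (auto simp: in_keys_iff lc lower_cover_def minimal_in_def split: if_splits)
    show "Poly_Mapping.lookup c q = Poly_Mapping.lookup c r" if "(q, r) \<in> C" for q r
    proof -
      have "q \<in> I \<longleftrightarrow> r \<in> I"
        using I(7)[of q r] I(7)[of r q] coloring_sym that by blast
      then show ?thesis by (simp add: lc)
    qed
    fix r
    have "(\<Sum>q. Poly_Mapping.lookup c q when the_lower_cover T q = r) =
        (\<Sum>q\<in>I. Poly_Mapping.lookup c q when the_lower_cover T q = r)"
      by (rule Sum_any.expand_superset[OF I(3)]) (auto simp: lc)
    also have "\<dots> = (\<Sum>q\<in>I. if p = r then l / of_nat (card I) else 0)"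
      using the_lower_cover_eq[OF I(6)] by (intro sum.cong) (auto simp: lc when_def)
    also have "\<dots> = (if p = r then l else 0)"
      using nz by (simp add: mult_of_nat_commute[of "card I"] divide_inverse mult.assoc)
    finally have flow: "(\<Sum>q. Poly_Mapping.lookup c q when the_lower_cover T q = r) =
      (if p = r then l else 0)" .
    show "Poly_Mapping.lookup (y - x) r =
        (\<Sum>q. Poly_Mapping.lookup c q when the_lower_cover T q = r) - Poly_Mapping.lookup c r"
      unfolding flow unfolding lc *(2,3)
      by (auto simp add: lookup_minus lookup_add lookup_fscale lookup_dot lookup_sum_dot I(3))
  qed
  then show ?thesis
    unfolding flow_space_def by blast
qed

lemma zero_flow_space: "(0 :: 'p \<Rightarrow>\<^sub>0 'f::ab_group_add) \<in> flow_space T C"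
proof -
  have "flow_of T C 0 (0 :: 'p \<Rightarrow>\<^sub>0 'f)"
    by (rule flow_ofI) simp_all
  then show ?thesis
    unfolding flow_space_def by blast
qed

lemma steps_flow_space:
  fixes x y :: "'p \<Rightarrow>\<^sub>0 'f::{division_ring,linordered_ring_strict}"
  assumes "(step1 T C)\<^sup>*\<^sup>* x y"
  shows "x - y \<in> flow_space T C"
  using assms
proof (induction rule: rtranclp_induct)
  case base
  then show ?case by (simp add: zero_flow_space)
next
  case (step y w)
  have "x - w = (x - y) - (w - y)" by simp
  then show ?case
    using flow_space_diff[OF step.IH step_flow_space[OF step.hyps(2)]] by (simp only:)
qed

lemma NT_flow_space: "NT T C \<subseteq> flow_space T C"
proof
  fix d assume "d \<in> NT T C"
  then obtain x y u where d: "d = x - y" and xy: "(step1 T C)\<^sup>*\<^sup>* x u" "(step1 T C)\<^sup>*\<^sup>* y u"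
    by (auto simp: NT_def tree_equiv_def)
  have "d = (x - u) - (y - u)"
    by (simp add: d)
  then show "d \<in> flow_space T C"
    using flow_space_diff[OF steps_flow_space[OF xy(1)] steps_flow_space[OF xy(2)]] by (simp only:)
qed

text \<open>
  On a deepest color class carrying flow, nothing arrives from above, so the two vectors differ there by
  a nonzero constant.  Each of them vanishes somewhere on the class, which forces the constant to be
  both nonpositive and nonnegative.
\<close>

lemma normal_form_unique:
  fixes u u' :: "'p \<Rightarrow>\<^sub>0 'f::{division_ring,linordered_ring_strict}"
  assumes "u \<in> free_pos T" "u' \<in> free_pos T" "normal T C u" "normal T C u'" "u - u' \<in> NT T C"
  shows "u = u'"
proof -
  obtain c where "flow_of T C c (u - u')"
    using assms(5) NT_flow_space unfolding flow_space_def by blast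
  note c = flow_ofD[OF this]
  have "Poly_Mapping.keys c = {}"
  proof (rule ccontr)
    assume ne: "Poly_Mapping.keys c \<noteq> {}"
    \<comment> \<open>Depth is measured at the lower cover, which is common to the members of a color class.\<close>
    define h where "h q = depth T (the_lower_cover T q)" for q
    obtain q where q: "q \<in> Poly_Mapping.keys c" "\<And>s. s \<in> Poly_Mapping.keys c \<Longrightarrow> h s \<le> h q"
      using Max_in[of "h ` Poly_Mapping.keys c"] Max_ge[of "h ` Poly_Mapping.keys c"] ne by fastforce
    have MT: "(the_lower_cover T q, C `` {q}) \<in> MT T C"
      using MT_class c(1)[OF q(1)] by blast
    have diff: "Poly_Mapping.lookup (u - u') r = - Poly_Mapping.lookup c q" if r: "r \<in> C `` {q}" for r
    proof -
      have lc: "lower_cover T (the_lower_cover T q) r"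
        using MT_facts(6)[OF MT r] .
      have "(Poly_Mapping.lookup c s when the_lower_cover T s = r) = 0" for s
      proof -
        have False if "s \<in> Poly_Mapping.keys c" "the_lower_cover T s = r"
          using q(2)[OF that(1)] depth_lower_cover[OF lc] that(2) by (simp add: h_def)
        then show ?thesis
          by (auto simp: when_def in_keys_iff)
      qed
      then show ?thesis
        using c(2)[of q r] c(3)[of r] r by simp
    qed
    obtain a b where ab: "a \<in> C `` {q}" "Poly_Mapping.lookup u a = 0" "b \<in> C `` {q}" "Poly_Mapping.lookup u' b = 0"
      using bspec[OF assms(3)[unfolded normal_def] MT] bspec[OF assms(4)[unfolded normal_def] MT] by auto
    have "Poly_Mapping.lookup u b \<ge> 0" "Poly_Mapping.lookup u' a \<ge> 0"
      using assms(1,2) by (simp_all add: free_pos_iff)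
    then have "Poly_Mapping.lookup c q = 0"
      using diff[OF ab(1)] diff[OF ab(3)] ab(2,4) by (simp add: lookup_minus)
    then show False
      using q(1) by (simp add: in_keys_iff)
  qed
  then have "Poly_Mapping.lookup c r = 0" for r
    by (simp flip: not_in_keys_iff_lookup_eq_zero)
  then have "Poly_Mapping.lookup (u - u') r = 0" for r
    by (simp add: c(3))
  then show ?thesis
    by (intro poly_mapping_eqI) (simp add: lookup_minus)
qed

section \<open>Traces of convex sets on the canonical generators\<close>

lemma bar_eq_iff:
  assumes "p \<in> carrier T" "q \<in> carrier T"
  shows "(bar T C p :: ('p \<Rightarrow>\<^sub>0 'f::{division_ring,linordered_ring_strict}) set) = bar T C q \<longleftrightarrow> p = q"
proof
  assume "(bar T C p :: ('p \<Rightarrow>\<^sub>0 'f) set) = bar T C q"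
  then have "(dot p :: 'p \<Rightarrow>\<^sub>0 'f) = dot q"
    using assms unfolding bar_def coset_eq_iff_diff_NT
    by (intro normal_form_unique dot_in_free_pos normal_dot)
  then have "Poly_Mapping.lookup (dot p :: 'p \<Rightarrow>\<^sub>0 'f) p = Poly_Mapping.lookup (dot q :: 'p \<Rightarrow>\<^sub>0 'f) p"
    by simp
  then show "p = q"
    by (simp add: lookup_dot split: if_splits)
qed simp

lemma bar_image_subset_iff:
  assumes "A \<subseteq> carrier T" "B \<subseteq> carrier T"
  shows "bar T C ` A \<subseteq> (bar T C ` B :: ('p \<Rightarrow>\<^sub>0 'f::{division_ring,linordered_ring_strict}) set set)
    \<longleftrightarrow> A \<subseteq> B"
proof
  assume sub: "bar T C ` A \<subseteq> (bar T C ` B :: ('p \<Rightarrow>\<^sub>0 'f) set set)"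
  show "A \<subseteq> B"
  proof
    fix p assume p: "p \<in> A"
    then have "(bar T C p :: ('p \<Rightarrow>\<^sub>0 'f) set) \<in> bar T C ` B"
      using sub by blast
    then obtain q where q: "(bar T C p :: ('p \<Rightarrow>\<^sub>0 'f) set) = bar T C q" "q \<in> B"
      by blast
    then have "p = q"
      using bar_eq_iff[of p q, where 'f='f] p assms by blast
    then show "p \<in> B"
      using q(2) by simp
  qed
qed (rule image_mono)

text \<open>
  The relation \<open>p = barycenter of I\<close> holds in \<open>VT T C\<close>, and a convex set contains the barycenters of its
  nonempty finite subsets.
\<close>

lemma step_closed_convex:
  fixes W :: "('p \<Rightarrow>\<^sub>0 'f::{division_ring,linordered_ring_strict}) set set"
  assumes "convex_in (VT T C) W"
  shows "step_closed T C {p \<in> carrier T. bar T C p \<in> W}"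
  unfolding step_closed_def
proof clarify
  fix p I assume pI: "(p, I) \<in> MT T C" and sub: "I \<subseteq> {p \<in> carrier T. bar T C p \<in> W}"
  note I = MT_facts[OF pI]
  define v :: "'p \<Rightarrow>\<^sub>0 'f" where "v = fscale (1 / of_nat (card I)) (\<Sum>q\<in>I. dot q)"
  have pos: "(0::'f) < of_nat (card I)"
    using I(4) by (intro ordered_ring_of_nat_pos) simp
  have v: "v \<in> free_pos T"
    unfolding v_def using I(2,3) ordered_ring_inverse_pos[OF pos]
    by (intro free_pos_closed sum_dot_in_free_pos) (auto simp: divide_inverse)
  have "v +o NT T C \<in> W"
  proof (rule convex_contains_combination[OF assms _ v])
    show "mass v = 1"
      using pos by (simp add: v_def mass_fscale mass_sum_dot I(3) divide_inverse)
    show "Poly_Mapping.keys v \<subseteq> I"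
      by (auto simp: v_def in_keys_iff lookup_fscale lookup_sum_dot I(3) split: if_splits)
  qed (use sub in auto)
  moreover have "step1 T C v (dot p)"
    by (rule step1I[OF pI ordered_ring_zero_le_one free_pos_closed(1) v dot_in_free_pos[OF I(1)]])
      (simp_all add: v_def fscale_simps)
  then have "v - dot p \<in> NT T C"
    by (intro steps_NT[OF _ v]) auto
  then have "v +o NT T C = bar T C p"
    by (simp add: bar_def coset_eq_iff_diff_NT)
  ultimately show "p \<in> carrier T \<and> bar T C p \<in> W"
    using I(1) by simp
qed

text \<open>
  A point of the hull is represented by a vector supported in \<open>A\<close>.  Reducing that vector stays in \<open>A\<close>
  and, by uniqueness, ends in the given normal form.
\<close>

lemma normal_form_in_conv:
  fixes u :: "'p \<Rightarrow>\<^sub>0 'f::{division_ring,linordered_ring_strict}"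
  assumes "step_closed T C A" "A \<subseteq> carrier T" "u \<in> free_pos T" "normal T C u"
    and "u +o NT T C \<in> conv (VT T C) (bar T C ` A)"
  shows "Poly_Mapping.keys u \<subseteq> A"
proof -
  obtain v where v: "u +o NT T C = v +o NT T C" "v \<in> free_pos T" "Poly_Mapping.keys v \<subseteq> A"
    using assms(5) unfolding conv_bar[OF assms(2)] by blast
  obtain w where w: "(step1 T C)\<^sup>*\<^sup>* v w" "normal T C w"
    using normal_form_exists[OF v(2)] by blast
  have "u - w = (u - v) + (v - w)" by simp
  then have "u - w \<in> NT T C"
    using NT_subspace(3)[OF iffD1[OF coset_eq_iff_diff_NT v(1)] steps_NT[OF w(1) v(2)]]
    by simp
  then have "u = w"
    using normal_form_unique[OF assms(3) steps_free_pos[OF w(1) v(2)] assms(4) w(2)] by blast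
  then show ?thesis
    using steps_keys[OF w(1) assms(1) v(3)] by simp
qed

lemma bar_in_conv_iff:
  assumes "step_closed T C A" "A \<subseteq> carrier T" "p \<in> carrier T"
  shows "(bar T C p :: ('p \<Rightarrow>\<^sub>0 'f::{division_ring,linordered_ring_strict}) set)
      \<in> conv (VT T C) (bar T C ` A) \<longleftrightarrow> p \<in> A"
proof
  assume "(bar T C p :: ('p \<Rightarrow>\<^sub>0 'f) set) \<in> conv (VT T C) (bar T C ` A)"
  then have "Poly_Mapping.keys (dot p :: 'p \<Rightarrow>\<^sub>0 'f) \<subseteq> A"
    using normal_form_in_conv[OF assms(1,2) dot_in_free_pos[OF assms(3)] normal_dot]
    by (simp add: bar_def[of T C p])
  then show "p \<in> A"
    by (simp add: dot_def)
qed (auto simp: conv_def intro: hull_inc)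

lemma bar_image_in_Co_rel:
  assumes "step_closed T C A" "A \<subseteq> carrier T"
  shows "(bar T C ` A :: ('p \<Rightarrow>\<^sub>0 'f::{division_ring,linordered_ring_strict}) set set)
      \<in> carrier (Co_rel (VT T C) (OmegaT T C))"
proof -
  let ?V = "VT T C :: ('f, ('p \<Rightarrow>\<^sub>0 'f) set) module"
  have "bar T C ` A \<subseteq> carrier ?V"
    using OmegaT_subset_carrier assms(2) by (fastforce simp: OmegaT_def)
  then have "convex_in ?V (conv ?V (bar T C ` A))"
    by (rule convex_in_conv[OF left_vector_space_VT])
  moreover have "bar T C ` A = conv ?V (bar T C ` A) \<inter> OmegaT T C"
    using bar_in_conv_iff[OF assms, where 'f='f] assms(2) by (auto simp: OmegaT_def)
  ultimately show ?thesis
    unfolding Co_rel_def partial_object.select_convs by blast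
qed

lemma Co_rel_OmegaT_cases:
  assumes "Z \<in> carrier (Co_rel (VT T C :: ('f::{division_ring,linordered_ring_strict}, ('p \<Rightarrow>\<^sub>0 'f) set) module) (OmegaT T C))"
  obtains A where "step_closed T C A" "A \<subseteq> carrier T" "Z = bar T C ` A"
proof -
  obtain W where "convex_in (VT T C) W" "Z = W \<inter> OmegaT T C"
    using assms by (auto simp: Co_rel_def)
  then show ?thesis
    by (intro that[OF step_closed_convex]) (auto simp: OmegaT_def)
qed

text \<open>
  The least trace is the image of the step-closure of the support of the normal form of the point:
  it contains the point in its hull, and every other trace with this property is the image of a
  step-closed set, which has to contain that support.
\<close>

lemma plenary_OmegaT:
  "plenary_set (VT T C :: ('f::{division_ring,linordered_ring_strict}, ('p \<Rightarrow>\<^sub>0 'f) set) module) (OmegaT T C)"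
  unfolding plenary_set_def
proof (intro conjI ballI OmegaT_subset_carrier)
  let ?V = "VT T C :: ('f, ('p \<Rightarrow>\<^sub>0 'f) set) module"
  let ?\<Omega> = "OmegaT T C :: ('p \<Rightarrow>\<^sub>0 'f) set set"
  fix X assume "X \<in> conv ?V ?\<Omega>"
  then obtain v where v: "X = v +o NT T C" "v \<in> free_pos T" "mass v = 1"
    unfolding OmegaT_image conv_bar[OF subset_refl] by blast
  obtain u where u: "(step1 T C)\<^sup>*\<^sup>* v u" "normal T C u"
    using normal_form_exists[OF v(2)] by blast
  have u_pos: "u \<in> free_pos T" and mass_u: "mass u = 1"
    using steps_free_pos[OF u(1) v(2)] steps_mass[OF u(1)] v(3) by auto
  have X: "X = u +o NT T C"
    using steps_NT[OF u(1) v(2)] by (simp add: v(1) coset_eq_iff_diff_NT)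
  define A where "A = \<Inter>{B. step_closed T C B \<and> B \<subseteq> carrier T \<and> Poly_Mapping.keys u \<subseteq> B}"
  have carrier: "step_closed T C (carrier T)"
    using MT_facts(1) by (auto simp: step_closed_def)
  have keys: "Poly_Mapping.keys u \<subseteq> carrier T"
    using u_pos by (simp add: free_pos_def free_space_def)
  have "step_closed T C A"
    unfolding A_def step_closed_def by blast
  moreover have "A \<subseteq> carrier T" "Poly_Mapping.keys u \<subseteq> A"
    using carrier keys by (auto simp: A_def)
  ultimately have A: "step_closed T C A" "A \<subseteq> carrier T" "Poly_Mapping.keys u \<subseteq> A"
    by blast+
  have least: "A \<subseteq> B" if "step_closed T C B" "B \<subseteq> carrier T" "Poly_Mapping.keys u \<subseteq> B" for B
    using that by (auto simp: A_def)
  show "\<exists>Y. least (Co_rel ?V ?\<Omega>) Y {Y \<in> carrier (Co_rel ?V ?\<Omega>). X \<in> conv ?V Y}"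
  proof (intro exI[of _ "bar T C ` A"] iffD2[OF least_def] conjI ballI CollectI)
    show "bar T C ` A \<in> carrier (Co_rel ?V ?\<Omega>)"
      by (rule bar_image_in_Co_rel[OF A(1,2)])
    show "X \<in> conv ?V (bar T C ` A)"
      unfolding conv_bar[OF A(2)] using X u_pos mass_u A(3) by blast
    fix Z assume Z: "Z \<in> {Y \<in> carrier (Co_rel ?V ?\<Omega>). X \<in> conv ?V Y}"
    then obtain B where B: "step_closed T C B" "B \<subseteq> carrier T" "Z = bar T C ` B"
      by (auto elim: Co_rel_OmegaT_cases)
    then have "Poly_Mapping.keys u \<subseteq> B"
      using Z X normal_form_in_conv[OF B(1,2) u_pos u(2)] by auto
    then show "bar T C ` A \<sqsubseteq>\<^bsub>Co_rel ?V ?\<Omega>\<^esub> Z"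
      using least[OF B(1,2)] B(3) by (auto simp: Co_rel_def)
  qed auto
qed

section \<open>Sublevel sets of a norm\<close>

text \<open>
  If \<open>x\<close> is an upper bound of \<open>e ` I\<close> for a color class \<open>I\<close> of upper covers of \<open>p\<close>, then \<open>x\<close> lies above
  the join of \<open>e ` I\<close>, which by the first condition on norms lies above \<open>e p\<close>.
\<close>

lemma norm_sublevel_step_closed:
  assumes L: "partial_order L" and norm: "valued_norm T C L e"
    and x: "x \<in> carrier L"
  shows "step_closed T C {p \<in> carrier T. e p \<sqsubseteq>\<^bsub>L\<^esub> x}"
  unfolding step_closed_def
proof clarify
  interpret partial_order L by fact
  fix p I assume pI: "(p, I) \<in> MT T C" and I: "I \<subseteq> {p \<in> carrier T. e p \<sqsubseteq>\<^bsub>L\<^esub> x}"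
  have p: "p \<in> carrier T"
    by (rule MT_facts(1)[OF pI])
  have e: "e q \<in> carrier L" if "q \<in> carrier T" for q
    using norm that by (auto simp: valued_norm_def nonzero_def)
  have "nontrivial_join_cover L (e p) (e ` I)"
    using norm pI unfolding valued_norm_def by fast
  then obtain s where s: "is_lub L s (e ` I)" "e p \<sqsubseteq>\<^bsub>L\<^esub> s"
    unfolding nontrivial_join_cover_def by blast
  have "x \<in> Upper L (e ` I)"
    using x I by (auto simp: Upper_def)
  then have "s \<sqsubseteq>\<^bsub>L\<^esub> x" "s \<in> carrier L"
    using s(1) Upper_closed[of L "e ` I"] unfolding least_def by blast+
  then show "p \<in> carrier T \<and> e p \<sqsubseteq>\<^bsub>L\<^esub> x"
    using p le_trans[OF s(2) _ e[OF p] _ x] by blast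
qed

text \<open>
  If \<open>e p\<close> lies below the join but below neither \<open>x\<close> nor \<open>y\<close>, then neither of these is the least
  element, so \<open>{x, y}\<close> is a nontrivial join-cover of \<open>e p\<close>.  The norm then provides a color class of
  upper covers of \<open>p\<close> contained in the union of the two sublevel sets.
\<close>

lemma norm_sublevel_join:
  assumes L: "upper_semilattice L" and norm: "valued_norm T C L e"
    and x: "x \<in> carrier L" and y: "y \<in> carrier L" and B: "step_closed T C B"
    and Bx: "{p \<in> carrier T. e p \<sqsubseteq>\<^bsub>L\<^esub> x} \<subseteq> B" and By: "{p \<in> carrier T. e p \<sqsubseteq>\<^bsub>L\<^esub> y} \<subseteq> B"
  shows "{p \<in> carrier T. e p \<sqsubseteq>\<^bsub>L\<^esub> x \<squnion>\<^bsub>L\<^esub> y} \<subseteq> B"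
proof clarify
  fix p assume p: "p \<in> carrier T" "e p \<sqsubseteq>\<^bsub>L\<^esub> x \<squnion>\<^bsub>L\<^esub> y"
  show "p \<in> B"
  proof (cases "e p \<sqsubseteq>\<^bsub>L\<^esub> x \<or> e p \<sqsubseteq>\<^bsub>L\<^esub> y")
    case True
    then show ?thesis using Bx By p(1) by blast
  next
    case False
    interpret upper_semilattice L by fact
    have ep: "e p \<in> carrier L"
      using norm p(1) by (auto simp: valued_norm_def nonzero_def)
    have "\<not> least L x (carrier L)"
    proof
      assume "least L x (carrier L)"
      then have "x \<squnion>\<^bsub>L\<^esub> y \<sqsubseteq>\<^bsub>L\<^esub> y"
        using x y by (intro join_le) (auto simp: least_def)
      then show False
        using False le_trans[OF p(2) _ ep join_closed[OF x y] y] by blast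
    qed
    moreover have "\<not> least L y (carrier L)"
    proof
      assume "least L y (carrier L)"
      then have "x \<squnion>\<^bsub>L\<^esub> y \<sqsubseteq>\<^bsub>L\<^esub> x"
        using x y by (intro join_le) (auto simp: least_def)
      then show False
        using False le_trans[OF p(2) _ ep join_closed[OF x y] x] by blast
    qed
    moreover have "is_lub L (x \<squnion>\<^bsub>L\<^esub> y) {x, y}"
      unfolding join_def using x y by (rule sup_of_two_least)
    ultimately have "nontrivial_join_cover L (e p) {x, y}"
      using False p(2) x y unfolding nontrivial_join_cover_def nonzero_def by blast
    then obtain I where I: "I \<in> MT_at T C p" "refines L (e ` I) {x, y}"
      using norm p(1) unfolding valued_norm_def by blast
    have pI: "(p, I) \<in> MT T C"
      using I(1) by (auto simp: MT_at_def MT_def)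
    have "I \<subseteq> B"
      using I(2) MT_facts(2)[OF pI] Bx By unfolding refines_def by blast
    then show ?thesis
      using B pI unfolding step_closed_def by blast
  qed
qed

end

section \<open>The representation theorem\<close>

theorem theorem9p2:
  fixes T :: "('p, 'm) gorder_scheme" and C :: "('p \<times> 'p) set"
    and L :: "('l, 'n) gorder_scheme" and e :: "'p \<Rightarrow> 'l"
    and V :: "('f::{division_ring,linordered_ring_strict}, ('p \<Rightarrow>\<^sub>0 'f) set) module"
    and \<Omega> :: "('p \<Rightarrow>\<^sub>0 'f) set set"
    and \<psi> \<phi> :: "'l \<Rightarrow> ('p \<Rightarrow>\<^sub>0 'f) set set"
  assumes "colored_tree T C"
    and "upper_semilattice L"
    and "valued_norm T C L e"
    and "V = VT T C"
    and "\<Omega> = OmegaT T C"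
    and "\<And>x. x \<in> carrier L \<Longrightarrow> \<psi> x = {bar T C p | p. p \<in> carrier T \<and> e p \<sqsubseteq>\<^bsub>L\<^esub> x}"
    and "\<And>x. x \<in> carrier L \<Longrightarrow> \<phi> x = conv V (\<psi> x)"
  shows "join_hom L (Co_rel V \<Omega>) \<psi> \<and> preserves_existing_meets L (Co_rel V \<Omega>) \<psi> \<and>
    (plenary_map L V \<phi> \<and> join_hom L (Co V) \<phi>) \<and>
    (zero_preserving L (Co_rel V \<Omega>) \<psi> \<and> zero_preserving L (Co V) \<phi>) \<and>
    (full_norm T L e \<longrightarrow> join_embedding L (Co_rel V \<Omega>) \<psi> \<and> join_embedding L (Co V) \<phi>)"
proof -
  note ct = assms(1) and norm = assms(3) and V = assms(4) and \<Omega> = assms(5)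
  interpret upper_semilattice L by fact
  have po: "partial_order L" by unfold_locales
  define D where "D x = {p \<in> carrier T. e p \<sqsubseteq>\<^bsub>L\<^esub> x}" for x
  have D_sub: "D x \<subseteq> carrier T" for x
    by (auto simp: D_def)
  have D_closed: "step_closed T C (D x)" if "x \<in> carrier L" for x
    unfolding D_def by (rule norm_sublevel_step_closed[OF ct po norm that])
  have e: "e p \<in> carrier L" "\<not> least L (e p) (carrier L)" if "p \<in> carrier T" for p
    using norm that by (auto simp: valued_norm_def nonzero_def)
  have D_mono: "D x \<subseteq> D y" if "x \<sqsubseteq>\<^bsub>L\<^esub> y" "x \<in> carrier L" "y \<in> carrier L" for x y
    using that e(1) by (auto simp: D_def intro: le_trans)
  have psi: "\<psi> x = bar T C ` D x" if "x \<in> carrier L" for x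
    using assms(6)[OF that] by (auto simp: D_def)
  note bar_image_subset = bar_image_subset_iff[OF ct, where 'f='f]
  have psi_mem: "\<psi> x \<in> carrier (Co_rel V \<Omega>)" if "x \<in> carrier L" for x
    unfolding psi[OF that] V \<Omega> by (rule bar_image_in_Co_rel[OF ct D_closed[OF that] D_sub])
  have psi_sub: "\<psi> x \<subseteq> \<Omega>" if "x \<in> carrier L" for x
    unfolding psi[OF that] \<Omega> OmegaT_image using D_sub by blast
  have Omega_sub: "\<Omega> \<subseteq> carrier V"
    unfolding V \<Omega> by (rule OmegaT_subset_carrier)
  have phi_convex: "convex_in V (\<phi> x)" if "x \<in> carrier L" for x
    unfolding assms(7)[OF that]
    using psi_sub[OF that] Omega_sub left_vector_space_VT by (intro convex_in_conv) (auto simp: V)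
  have psi_sub_phi: "\<psi> x \<subseteq> \<phi> x" if "x \<in> carrier L" for x
    unfolding assms(7)[OF that] conv_def by (rule hull_subset)
  have le_rel: "X \<sqsubseteq>\<^bsub>Co_rel V \<Omega>\<^esub> Y \<longleftrightarrow> X \<subseteq> Y" for X Y
    by (simp add: Co_rel_def)
  have psi_join: "\<psi> (x \<squnion>\<^bsub>L\<^esub> y) \<subseteq> Z"
    if xy: "x \<in> carrier L" "y \<in> carrier L" and Z: "Z \<in> carrier (Co_rel V \<Omega>)" "\<psi> x \<subseteq> Z" "\<psi> y \<subseteq> Z"
    for x y Z
  proof -
    obtain B where B: "step_closed T C B" "B \<subseteq> carrier T" "Z = bar T C ` B"
      using Z(1) unfolding V \<Omega> by (rule Co_rel_OmegaT_cases[OF ct])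
    have "D x \<subseteq> B" "D y \<subseteq> B"
      using Z(2,3) by (simp_all add: psi xy B(3) bar_image_subset[OF D_sub B(2)])
    then have "D (x \<squnion>\<^bsub>L\<^esub> y) \<subseteq> B"
      unfolding D_def using norm_sublevel_join[OF ct assms(2) norm xy B(1)] by blast
    then show ?thesis
      unfolding psi[OF join_closed[OF xy]] B(3) by blast
  qed
  have psi_mono: "\<psi> x \<subseteq> \<psi> y" if "x \<sqsubseteq>\<^bsub>L\<^esub> y" "x \<in> carrier L" "y \<in> carrier L" for x y
    using D_mono[OF that] by (auto simp: psi that)
  have psi_upper: "\<psi> x \<subseteq> \<psi> (x \<squnion>\<^bsub>L\<^esub> y)" "\<psi> y \<subseteq> \<psi> (x \<squnion>\<^bsub>L\<^esub> y)"
    if "x \<in> carrier L" "y \<in> carrier L" for x y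
    by (intro psi_mono join_left join_right join_closed that)+

  have hom_psi: "join_hom L (Co_rel V \<Omega>) \<psi>"
    unfolding join_hom_def
  proof (intro conjI ballI Pi_I psi_mem)
    fix x y assume xy: "x \<in> carrier L" "y \<in> carrier L"
    show "is_lub (Co_rel V \<Omega>) (\<psi> (x \<squnion>\<^bsub>L\<^esub> y)) {\<psi> x, \<psi> y}"
      using psi_mem[OF join_closed[OF xy]] psi_mem[OF xy(1)] psi_mem[OF xy(2)] psi_upper[OF xy] psi_join[OF xy]
      unfolding least_def Upper_def by (simp add: le_rel)
  qed

  have meets_psi: "preserves_existing_meets L (Co_rel V \<Omega>) \<psi>"
    unfolding preserves_existing_meets_def
  proof (intro allI impI)
    fix X m assume X: "X \<subseteq> carrier L" and m: "is_glb L m X"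
    have mL: "m \<in> carrier L" and m_le: "\<And>x. x \<in> X \<Longrightarrow> m \<sqsubseteq>\<^bsub>L\<^esub> x"
      using m X by (auto simp: greatest_def Lower_def)
    have glb: "Z \<subseteq> \<psi> m" if Z: "Z \<in> carrier (Co_rel V \<Omega>)" "\<And>x. x \<in> X \<Longrightarrow> Z \<subseteq> \<psi> x" for Z
    proof -
      obtain B where B: "step_closed T C B" "B \<subseteq> carrier T" "Z = bar T C ` B"
        using Z(1) unfolding V \<Omega> by (rule Co_rel_OmegaT_cases[OF ct])
      have "B \<subseteq> D x" if "x \<in> X" for x
        using Z(2)[OF that] X that by (auto simp: psi B(3) bar_image_subset[OF B(2) D_sub] subset_iff[of X])
      then have "e p \<in> Lower L X" if "p \<in> B" for p
        using that B(2) e(1) by (auto simp: Lower_def D_def)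
      then have "B \<subseteq> D m"
        using m B(2) by (auto simp: greatest_def D_def)
      then show ?thesis
        unfolding psi[OF mL] B(3) by blast
    qed
    show "is_glb (Co_rel V \<Omega>) (\<psi> m) (\<psi> ` X)"
      unfolding greatest_def
    proof (intro conjI ballI)
      show "\<psi> m \<in> Lower (Co_rel V \<Omega>) (\<psi> ` X)"
      proof -
        have "\<psi> m \<subseteq> \<psi> x" if "x \<in> X" for x
          using psi_mono[OF m_le[OF that] mL] X that by blast
        then show ?thesis
          using psi_mem[OF mL] unfolding Lower_def by (simp add: le_rel image_iff) blast
      qed
      fix Z assume "Z \<in> Lower (Co_rel V \<Omega>) (\<psi> ` X)"
      then have "Z \<in> carrier (Co_rel V \<Omega>)" "\<And>x. x \<in> X \<Longrightarrow> Z \<subseteq> \<psi> x"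
        using X psi_mem by (auto simp: Lower_def le_rel)
      then show "Z \<sqsubseteq>\<^bsub>Co_rel V \<Omega>\<^esub> \<psi> m"
        unfolding le_rel by (rule glb)
    qed (rule Lower_closed)
  qed

  have hom_phi: "join_hom L (Co V) \<phi>"
    unfolding join_hom_def
  proof (intro conjI ballI Pi_I)
    fix x assume "x \<in> carrier L"
    then show "\<phi> x \<in> carrier (Co V)"
      using phi_convex by (simp add: Co_def)
  next
    fix x y assume xy: "x \<in> carrier L" "y \<in> carrier L"
    note j = join_closed[OF xy]
    have up: "\<phi> x \<subseteq> \<phi> (x \<squnion>\<^bsub>L\<^esub> y)" "\<phi> y \<subseteq> \<phi> (x \<squnion>\<^bsub>L\<^esub> y)"
      unfolding assms(7)[OF xy(1)] assms(7)[OF xy(2)] assms(7)[OF j] conv_def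
      by (rule hull_mono, rule psi_upper[OF xy])+
    have "\<phi> (x \<squnion>\<^bsub>L\<^esub> y) \<subseteq> W" if W: "convex_in V W" "\<phi> x \<subseteq> W" "\<phi> y \<subseteq> W" for W
    proof -
      have "\<psi> x \<subseteq> W \<inter> \<Omega>" "\<psi> y \<subseteq> W \<inter> \<Omega>"
        using W(2,3) psi_sub_phi[OF xy(1)] psi_sub_phi[OF xy(2)] psi_sub[OF xy(1)] psi_sub[OF xy(2)]
        by simp_all
      moreover have "W \<inter> \<Omega> \<in> carrier (Co_rel V \<Omega>)"
        using W(1) by (auto simp: Co_rel_def)
      ultimately have "\<psi> (x \<squnion>\<^bsub>L\<^esub> y) \<subseteq> W"
        using psi_join[OF xy, of "W \<inter> \<Omega>"] by blast
      then show ?thesis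
        unfolding assms(7)[OF j] conv_def using W(1) by (rule hull_minimal)
    qed
    then show "is_lub (Co V) (\<phi> (x \<squnion>\<^bsub>L\<^esub> y)) {\<phi> x, \<phi> y}"
      using up phi_convex[OF j] phi_convex[OF xy(1)] phi_convex[OF xy(2)]
      unfolding least_def Upper_def by (simp add: Co_def)
  qed

  have plenary: "plenary_map L V \<phi>"
    unfolding plenary_map_def
  proof (intro exI conjI)
    show "plenary_set V \<Omega>"
      unfolding V \<Omega> by (rule plenary_OmegaT[OF ct])
  qed (use hom_psi meets_psi assms(7) in auto)

  have psi_zero: "\<psi> z = {}" if z: "least L z (carrier L)" for z
  proof -
    have zL: "z \<in> carrier L" and z_le: "\<And>y. y \<in> carrier L \<Longrightarrow> z \<sqsubseteq>\<^bsub>L\<^esub> y"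
      using z by (auto simp: least_def)
    have "least L (e p) (carrier L)" if "p \<in> D z" for p
      using that e(1)[of p] zL z_le by (auto simp: least_def D_def intro: le_trans)
    then have "D z = {}"
      using e(2) D_sub by blast
    then show ?thesis
      using psi[OF zL] by simp
  qed
  have zero_psi: "zero_preserving L (Co_rel V \<Omega>) \<psi>"
    unfolding zero_preserving_def
  proof (intro allI impI)
    fix z assume z: "least L z (carrier L)"
    then have "z \<in> carrier L" by (simp add: least_def)
    then show "least (Co_rel V \<Omega>) (\<psi> z) (carrier (Co_rel V \<Omega>))"
      using psi_mem[of z] unfolding least_def psi_zero[OF z] by (simp add: le_rel)
  qed
  have zero_phi: "zero_preserving L (Co V) \<phi>"
    unfolding zero_preserving_def
  proof (intro allI impI)
    fix z assume z: "least L z (carrier L)"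
    then have zL: "z \<in> carrier L" by (simp add: least_def)
    have convex: "convex_in V {}"
      by (simp add: convex_in_def)
    then have "\<phi> z = {}"
      unfolding assms(7)[OF zL] psi_zero[OF z] conv_def by (rule hull_same)
    then show "least (Co V) (\<phi> z) (carrier (Co V))"
      using convex by (simp add: least_def Co_def)
  qed

  have embeddings: "join_embedding L (Co_rel V \<Omega>) \<psi> \<and> join_embedding L (Co V) \<phi>"
    if full: "full_norm T L e"
  proof -
    have inj_psi: "inj_on \<psi> (carrier L)"
    proof (rule inj_onI)
      fix x y assume xy: "x \<in> carrier L" "y \<in> carrier L" "\<psi> x = \<psi> y"
      then have "D x = D y"
        using bar_image_subset[OF D_sub D_sub, of x y] bar_image_subset[OF D_sub D_sub, of y x]
        by (simp add: psi)
      moreover have "is_lub L z (e ` D z)" if "z \<in> carrier L" for z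
      proof -
        have "{a \<in> e ` carrier T. a \<sqsubseteq>\<^bsub>L\<^esub> z} = e ` D z"
          by (auto simp: D_def)
        then show ?thesis
          using bspec[OF full[unfolded full_norm_def] that] by (simp only:)
      qed
      ultimately have "is_lub L x (e ` D x)" "is_lub L y (e ` D x)"
        using xy(1,2) by metis+
      then show "x = y"
        by (rule least_unique)
    qed
    have psi_phi: "\<psi> x = \<phi> x \<inter> \<Omega>" if "x \<in> carrier L" for x
    proof -
      have "p \<in> D x" if "p \<in> carrier T" "bar T C p \<in> \<phi> x" for p
        using that bar_in_conv_iff[OF ct D_closed[OF \<open>x \<in> carrier L\<close>] D_sub that(1), where 'f='f]
        by (simp add: assms(7)[OF \<open>x \<in> carrier L\<close>] psi[OF \<open>x \<in> carrier L\<close>] V)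
      then have "\<phi> x \<inter> \<Omega> \<subseteq> \<psi> x"
        unfolding psi[OF that] \<Omega> OmegaT_image by blast
      then show ?thesis
        using psi_sub[OF that] psi_sub_phi[OF that] by blast
    qed
    have "inj_on \<phi> (carrier L)"
    proof (rule inj_onI)
      fix x y assume "x \<in> carrier L" "y \<in> carrier L" "\<phi> x = \<phi> y"
      then show "x = y"
        using psi_phi inj_onD[OF inj_psi] by simp
    qed
    then show ?thesis
      unfolding join_embedding_def using hom_psi hom_phi inj_psi by blast
  qed
  show ?thesis
    using hom_psi meets_psi plenary hom_phi zero_psi zero_phi embeddings by blast
qed

end
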